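(* Let $A_1,\ldots,A_m,B_1,\ldots,B_m\in\mathbb{P}_n$ and let $\Phi:\mathbb{M}_n\to\mathbb{M}_d$ be a positive linear map. Then for every symmetric norm $\|\cdot\|$ on $\mathbb{M}_d$ and every non-decreasing geometrically convex function $g$, the map $$(t_1,\ldots,t_m)\mapsto \Big\| g\Big(\Phi\Big(\sum_{i=1}^m A_i\#_{t_i}B_i\Big)\Big)\Big\|$$ is jointly log-convex on $\mathbb{R}^m$.
   Context: $\mathbb{M}_n$ denotes the space of $n\times n$ complex matrices, $\mathbb{M}_n^+$ its positive semidefinite cone and $\mathbb{P}_n$ its positive definite cone. For $A,B\in\mathbb{P}_n$ and $t\in\mathbb{R}$, the weighted geometric mean is $A\#_tB=A^{1/2}(A^{-1/2}BA^{-1/2})^tA^{1/2}$ (this parametrizes the geodesic through $A$ and $B$ in the Riemannian manifold $\mathbb{P}_n$). A linear map $\Phi:\mathbb{M}_n\to\mathbb{M}_d$ is positive if $\Phi(\mathbb{M}_n^+)\subset\mathbb{M}_d^+$. A symmetric norm on $\mathbb{M}_d$ is a norm satisfying $\|UAV\|=\|A\|$ for all $A\in\mathbb{M}_d$ and all unitary $U,V$. A function $g:[0,\infty)\to[0,\infty)$ is geometrically convex if it is continuous, non-negative, and $g(\sqrt{ab})\le\sqrt{g(a)g(b)}$ for all $a,b>0$; $g$ is applied to positive semidefinite matrices by functional calculus. A function $F:\mathbb{R}^m\to[0,\infty)$ is jointly log-convex if $F((x+y)/2)\le\sqrt{F(x)F(y)}$ for all $x,y\in\mathbb{R}^m$.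 *)

theory Defs
  imports "HOL-Analysis.Analysis"
begin

definition mat_adj :: "complex^'n^'m \<Rightarrow> complex^'m^'n" where
  "mat_adj A = (\<chi> i j. cnj (A $ j $ i))"

definition unitary_mat :: "complex^'n^'n \<Rightarrow> bool" where
  "unitary_mat U \<longleftrightarrow> mat_adj U ** U = mat 1 \<and> U ** mat_adj U = mat 1"

definition hermitian :: "complex^'n^'n \<Rightarrow> bool" where
  "hermitian A \<longleftrightarrow> mat_adj A = A"

definition qform :: "complex^'n^'n \<Rightarrow> complex^'n \<Rightarrow> complex" where
  "qform A x = (\<Sum>i\<in>UNIV. cnj (x $ i) * (A *v x) $ i)"

definition psd :: "complex^'n^'n \<Rightarrow> bool" where
  "psd A \<longleftrightarrow> (\<forall>x. Im (qform A x) = 0 \<and> Re (qform A x) \<ge> 0)"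

definition pd :: "complex^'n^'n \<Rightarrow> bool" where
  "pd A \<longleftrightarrow> (\<forall>x. x \<noteq> 0 \<longrightarrow> Im (qform A x) = 0 \<and> Re (qform A x) > 0)"

definition diag_mat :: "('n \<Rightarrow> complex) \<Rightarrow> complex^'n^'n" where
  "diag_mat f = (\<chi> i j. if i = j then f i else 0)"

definition mat_fun :: "(real \<Rightarrow> real) \<Rightarrow> complex^'n^'n \<Rightarrow> complex^'n^'n" where
  "mat_fun f A = (SOME B. \<exists>U lam. unitary_mat U \<and>
       A = U ** diag_mat (\<lambda>i. complex_of_real (lam i)) ** mat_adj U \<and>
       B = U ** diag_mat (\<lambda>i. complex_of_real (f (lam i))) ** mat_adj U)"

definition gmean :: "complex^'n^'n \<Rightarrow> real \<Rightarrow> complex^'n^'n \<Rightarrow> complex^'n^'n" where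
  "gmean A t B =
     (let Ah = mat_fun (\<lambda>x. x powr (1/2)) A;
          Amh = mat_fun (\<lambda>x. x powr (-1/2)) A
      in Ah ** mat_fun (\<lambda>x. x powr t) (Amh ** B ** Amh) ** Ah)"

definition mat_scale :: "complex \<Rightarrow> complex^'n^'m \<Rightarrow> complex^'n^'m" where
  "mat_scale c A = (\<chi> i j. c * A $ i $ j)"

definition clinear_map :: "(complex^'n^'n \<Rightarrow> complex^'d^'d) \<Rightarrow> bool" where
  "clinear_map \<Phi> \<longleftrightarrow> (\<forall>A B. \<Phi> (A + B) = \<Phi> A + \<Phi> B) \<and>
                        (\<forall>c A. \<Phi> (mat_scale c A) = mat_scale c (\<Phi> A))"

definition positive_map :: "(complex^'n^'n \<Rightarrow> complex^'d^'d) \<Rightarrow> bool" where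
  "positive_map \<Phi> \<longleftrightarrow> clinear_map \<Phi> \<and> (\<forall>A. psd A \<longrightarrow> psd (\<Phi> A))"

definition symmetric_norm :: "(complex^'d^'d \<Rightarrow> real) \<Rightarrow> bool" where
  "symmetric_norm N \<longleftrightarrow>
     (\<forall>A. N A \<ge> 0) \<and> (\<forall>A. N A = 0 \<longleftrightarrow> A = 0) \<and>
     (\<forall>c A. N (mat_scale c A) = cmod c * N A) \<and>
     (\<forall>A B. N (A + B) \<le> N A + N B) \<and>
     (\<forall>A U V. unitary_mat U \<longrightarrow> unitary_mat V \<longrightarrow> N (U ** A ** V) = N A)"

definition geom_convex :: "(real \<Rightarrow> real) \<Rightarrow> bool" where
  "geom_convex g \<longleftrightarrow> continuous_on {0..} g \<and> (\<forall>x\<ge>0. g x \<ge> 0) \<and>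
     (\<forall>a b. a > 0 \<longrightarrow> b > 0 \<longrightarrow> g (sqrt (a * b)) \<le> sqrt (g a * g b))"

definition joint_log_convex :: "(real^'m \<Rightarrow> real) \<Rightarrow> bool" where
  "joint_log_convex F \<longleftrightarrow> (\<forall>x. F x \<ge> 0) \<and>
     (\<forall>x y. F ((1/2) *\<^sub>R (x + y)) \<le> sqrt (F x * F y))"

end

theory Submission
  imports Defs
begin

text \<open>
  Diagonalizing \<open>A\<^bsup>-1/2\<^esup> B A\<^bsup>-1/2\<^esup>\<close> turns each geodesic into a sum of fixed rank one matrices with
  weights \<open>c\<^sup>t\<close>, so \<open>F t = \<Phi> (\<Sum>i. gmean (A i) (t i) (B i))\<close> is a sum of positive semidefinite matrices
  with exponential weights, and the block matrix with rows \<open>F x, F ((x + y)/2)\<close> and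
  \<open>F ((x + y)/2), F y\<close> is positive semidefinite. For a positive semidefinite block matrix with
  rows \<open>P, R\<close> and \<open>R, Q\<close>, a determinant argument shows that the eigenvalues of \<open>R\<close> are weakly
  log-majorized by the geometric means of the sorted eigenvalues of \<open>P\<close> and \<open>Q\<close>. Since
  \<open>g \<circ> exp\<close> is convex and non-decreasing, this becomes a weak majorization after applying \<open>g\<close>, which
  symmetric norms respect. The bound \<open>\<surd>(\<alpha>\<beta>) \<le> (c\<alpha> + \<beta>/c)/2\<close>, optimized over \<open>c\<close>, yields the product form.
\<close>

section \<open>Complex inner product and unitary diagonalization\<close>

definition cip :: "complex^'n \<Rightarrow> complex^'n \<Rightarrow> complex" where
  "cip x y = (\<Sum>i\<in>UNIV. cnj (x $ i) * y $ i)"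

lemma cip_add_left: "cip (x + y) z = cip x z + cip y z"
  by (simp add: cip_def algebra_simps sum.distrib)

lemma cip_add_right: "cip x (y + z) = cip x y + cip x z"
  by (simp add: cip_def algebra_simps sum.distrib)

lemma cip_diff_right: "cip x (y - z) = cip x y - cip x z"
  by (simp add: cip_def algebra_simps sum_subtractf)

lemma cip_scale_left: "cip (c *s x) y = cnj c * cip x y"
  by (simp add: cip_def sum_distrib_left algebra_simps)

lemma cip_scale_right: "cip x (c *s y) = c * cip x y"
  by (simp add: cip_def sum_distrib_left algebra_simps)

lemma cip_scaleR_right: "cip x (c *\<^sub>R y) = of_real c * cip x y"
proof -
  have "(c *\<^sub>R y) $ i = of_real c * y $ i" for i
    by (simp add: vector_scaleR_component) (simp add: scaleR_conv_of_real)
  then show ?thesis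
    by (simp add: cip_def sum_distrib_left mult.left_commute)
qed

lemma cip_zero [simp]: "cip 0 x = 0" "cip x 0 = 0"
  by (simp_all add: cip_def)

lemma cip_commute: "cip y x = cnj (cip x y)"
  by (simp add: cip_def mult.commute)

lemma cip_scaleR_left: "cip (c *\<^sub>R x) y = of_real c * cip x y"
  by (simp add: cip_commute[of "c *\<^sub>R x" y] cip_scaleR_right flip: cip_commute)

lemma cip_self: "cip x x = of_real ((norm x)\<^sup>2)"
proof -
  have "cnj (x $ i) * x $ i = of_real ((norm (x $ i))\<^sup>2)" for i
    by (metis complex_norm_square mult.commute)
  then show ?thesis
    by (simp add: cip_def norm_vec_def L2_set_def sum_nonneg)
qed

lemma Re_cip_eq_inner: "Re (cip x y) = inner x y"
  by (simp add: cip_def inner_vec_def inner_complex_def)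

lemma cip_self_Re: "Re (cip x x) = (norm x)\<^sup>2"
  by (simp add: cip_self)

lemma cip_axis: "cip (axis i 1) y = y $ i"
  by (simp add: cip_def axis_def if_distrib if_distribR sum.delta cong: if_cong)

lemma cip_adj: "cip x (A *v y) = cip (mat_adj A *v x) y"
proof -
  have "cip x (A *v y) = (\<Sum>i\<in>UNIV. \<Sum>j\<in>UNIV. cnj (x $ i) * (A $ i $ j * y $ j))"
    by (simp add: cip_def matrix_vector_mult_def sum_distrib_left)
  also have "\<dots> = (\<Sum>j\<in>UNIV. \<Sum>i\<in>UNIV. cnj (x $ i) * (A $ i $ j * y $ j))"
    by (rule sum.swap)
  also have "\<dots> = cip (mat_adj A *v x) y"
    by (simp add: cip_def matrix_vector_mult_def mat_adj_def sum_distrib_left mult_ac)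
  finally show ?thesis .
qed

lemma qform_cip: "qform A x = cip x (A *v x)"
  by (simp add: qform_def cip_def)

lemma mat_adj_adj [simp]: "mat_adj (mat_adj A) = A"
  by (simp add: mat_adj_def vec_eq_iff)

lemma mat_adj_mul: "mat_adj (A ** B) = mat_adj B ** mat_adj A"
  by (simp add: mat_adj_def matrix_matrix_mult_def vec_eq_iff mult.commute)

lemma mat_adj_add: "mat_adj (A + B) = mat_adj A + mat_adj B"
  by (simp add: mat_adj_def vec_eq_iff)

lemma mat_adj_mat1 [simp]: "mat_adj (mat 1) = mat 1"
  by (simp add: mat_adj_def mat_def vec_eq_iff)

lemma mat_adj_diag_real: "mat_adj (diag_mat (\<lambda>i. complex_of_real (l i))) = diag_mat (\<lambda>i. of_real (l i))"
  by (simp add: mat_adj_def diag_mat_def vec_eq_iff)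

lemma diag_mat_left: "(diag_mat f ** A) $ i $ j = f i * A $ i $ j"
proof -
  have "(diag_mat f ** A) $ i $ j = (\<Sum>k\<in>UNIV. if k = i then f i * A $ i $ j else 0)"
    unfolding matrix_matrix_mult_def vec_lambda_beta by (rule sum.cong) (auto simp: diag_mat_def)
  then show ?thesis by simp
qed

lemma diag_mat_right: "(A ** diag_mat f) $ i $ j = A $ i $ j * f j"
proof -
  have "(A ** diag_mat f) $ i $ j = (\<Sum>k\<in>UNIV. if k = j then A $ i $ j * f j else 0)"
    unfolding matrix_matrix_mult_def vec_lambda_beta by (rule sum.cong) (auto simp: diag_mat_def)
  then show ?thesis by simp
qed

lemma diag_mat_mul: "diag_mat f ** diag_mat g = diag_mat (\<lambda>i. f i * g i)"
  by (simp add: vec_eq_iff diag_mat_left) (simp add: diag_mat_def)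

lemma diag_mat_one: "diag_mat (\<lambda>_. 1) = mat 1"
  by (simp add: diag_mat_def mat_def)

lemma diag_mat_vec: "(diag_mat f *v x) $ i = f i * x $ i"
proof -
  have "(diag_mat f *v x) $ i = (\<Sum>k\<in>UNIV. if k = i then f i * x $ i else 0)"
    unfolding matrix_vector_mult_def vec_lambda_beta by (rule sum.cong) (auto simp: diag_mat_def)
  then show ?thesis by simp
qed

lemma matrix_add_vec: "(A + B) *v x = A *v x + B *v (x :: complex^'n)"
  by (rule matrix_vector_mult_add_rdistrib)

lemma scaleR_matrix_vec: "(c *\<^sub>R A) *v (x :: complex^'n) = c *\<^sub>R (A *v x)"
  by (simp add: vec_eq_iff matrix_vector_mult_def scaleR_sum_right)

lemma matrix_vec_scaleR: "A *v (c *\<^sub>R x) = c *\<^sub>R (A *v (x :: complex^'n))"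
  by (simp add: vec_eq_iff matrix_vector_mult_def scaleR_sum_right)

lemma matrix_add_rdistrib: "(A + B) ** C = A ** C + B ** (C :: complex^'n^'m)"
  by (simp add: vec_eq_iff matrix_matrix_mult_def algebra_simps sum.distrib)

section \<open>Matrices given by a diagonalization\<close>

text \<open>The shape matches the decompositions in \<open>mat_fun\<close>. \<open>U\<close> may be
  any matrix, so that congruences keep the same form, as in \<open>udiag_conj\<close>.\<close>

definition udiag :: "complex^'n^'n \<Rightarrow> ('n \<Rightarrow> real) \<Rightarrow> complex^'n^'n" where
  "udiag U l = U ** diag_mat (\<lambda>i. complex_of_real (l i)) ** mat_adj U"

lemma mat_adj_udiag: "mat_adj (udiag U l) = udiag U l"
  unfolding udiag_def mat_adj_mul mat_adj_diag_real mat_adj_adj by (simp only: matrix_mul_assoc)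

lemma hermitian_udiag: "hermitian (udiag U l)"
  by (simp add: hermitian_def mat_adj_udiag)

lemma udiag_mul:
  assumes "unitary_mat U"
  shows "udiag U l ** udiag U k = udiag U (\<lambda>i. l i * k i)"
proof -
  have "udiag U l ** udiag U k
      = U ** diag_mat (\<lambda>i. of_real (l i)) ** (mat_adj U ** U) ** diag_mat (\<lambda>i. of_real (k i)) ** mat_adj U"
    by (simp add: udiag_def matrix_mul_assoc)
  also have "\<dots> = U ** (diag_mat (\<lambda>i. of_real (l i)) ** diag_mat (\<lambda>i. of_real (k i))) ** mat_adj U"
    using assms by (simp add: unitary_mat_def matrix_mul_assoc)
  finally show ?thesis by (simp add: diag_mat_mul udiag_def)
qed

lemma udiag_one: "unitary_mat U \<Longrightarrow> udiag U (\<lambda>_. 1) = mat 1"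
  by (simp add: udiag_def diag_mat_one unitary_mat_def)

lemma diag_mat_add: "diag_mat f + diag_mat g = diag_mat (\<lambda>i. f i + g i)"
  by (simp add: diag_mat_def vec_eq_iff)

lemma udiag_add: "udiag U l + udiag U k = udiag U (\<lambda>i. l i + k i)"
  by (simp add: udiag_def matrix_add_ldistrib matrix_add_rdistrib flip: diag_mat_add)

lemma udiag_scale: "c *\<^sub>R udiag U l = udiag U (\<lambda>i. c * l i)"
proof -
  have "c *\<^sub>R udiag U l = U ** (c *\<^sub>R diag_mat (\<lambda>i. of_real (l i))) ** mat_adj U"
    by (simp only: udiag_def matrix_scalar_ac scalar_matrix_assoc)
  also have "c *\<^sub>R diag_mat (\<lambda>i. complex_of_real (l i)) = diag_mat (\<lambda>i. of_real (c * l i))"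
    by (simp add: diag_mat_def vec_eq_iff) (simp add: scaleR_conv_of_real)
  finally show ?thesis by (simp add: udiag_def)
qed

lemma udiag_conj: "X ** udiag U l ** mat_adj X = udiag (X ** U) l"
  by (simp add: udiag_def mat_adj_mul matrix_mul_assoc)

lemma unitary_mat_mul: "unitary_mat U \<Longrightarrow> unitary_mat V \<Longrightarrow> unitary_mat (U ** V)"
proof -
  assume U: "unitary_mat U" and V: "unitary_mat V"
  have "mat_adj (U ** V) ** (U ** V) = mat_adj V ** (mat_adj U ** U) ** V"
    by (simp add: mat_adj_mul matrix_mul_assoc)
  moreover have "(U ** V) ** mat_adj (U ** V) = U ** (V ** mat_adj V) ** mat_adj U"
    by (simp add: mat_adj_mul matrix_mul_assoc)
  ultimately show ?thesis using U V by (simp add: unitary_mat_def)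
qed

lemma unitary_mat_adj: "unitary_mat U \<Longrightarrow> unitary_mat (mat_adj U)"
  by (simp add: unitary_mat_def)

lemma unitary_mat_1: "unitary_mat (mat 1)"
  by (simp add: unitary_mat_def)

lemma qform_udiag:
  "cip x (udiag U l *v x) = of_real (\<Sum>i\<in>UNIV. l i * (cmod ((mat_adj U *v x) $ i))\<^sup>2)"
proof -
  let ?y = "mat_adj U *v x"
  have "cip x (udiag U l *v x) = cip ?y (diag_mat (\<lambda>i. of_real (l i)) *v ?y)"
    by (simp add: udiag_def cip_adj[of x U] flip: matrix_vector_mul_assoc)
  also have "\<dots> = (\<Sum>i\<in>UNIV. of_real (l i) * (?y $ i * cnj (?y $ i)))"
    by (simp add: cip_def diag_mat_vec algebra_simps)
  finally show ?thesis
    by (simp add: complex_norm_square[symmetric] flip: of_real_power)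
qed

lemma qform_udiag_mono:
  assumes "\<And>i. l i \<le> k i"
  shows "Re (cip x (udiag U l *v x)) \<le> Re (cip x (udiag U k *v x))"
  by (simp add: qform_udiag sum_mono mult_right_mono assms)

lemma udiag_eigenvector:
  assumes "unitary_mat U"
  shows "cip (U *v axis i 1) (udiag U l *v (U *v axis i 1)) = of_real (l i)"
    and "U *v axis i 1 \<noteq> 0"
proof -
  have *: "mat_adj U *v (U *v axis i 1) = (axis i 1 :: complex^'a)"
    using assms by (simp add: matrix_vector_mul_assoc unitary_mat_def)
  show "cip (U *v axis i 1) (udiag U l *v (U *v axis i 1)) = of_real (l i)"
    by (simp add: qform_udiag *) (simp add: axis_def if_distrib if_distribR sum.delta cong: if_cong)
  have "mat_adj U *v 0 \<noteq> (axis i 1 :: complex^'a)"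
    by (metis axis_eq_0_iff matrix_vector_mult_0_right one_neq_zero)
  then show "U *v axis i 1 \<noteq> 0" using * by metis
qed

lemma det_diag_mat: "det (diag_mat f :: complex^'n^'n) = (\<Prod>i\<in>UNIV. f i)"
  by (subst det_diagonal) (simp_all add: diag_mat_def)

lemma det_mat_adj: "det (mat_adj A) = cnj (det (A :: complex^'n^'n))"
proof -
  have "det (mat_adj A) = det (transpose (\<chi> i j. cnj (A $ i $ j)))"
    by (simp add: mat_adj_def transpose_def)
  also have "\<dots> = cnj (det A)"
    by (simp add: det_transpose) (simp add: det_def)
  finally show ?thesis .
qed

lemma det_udiag:
  assumes "unitary_mat U"
  shows "det (udiag U l) = (\<Prod>i\<in>UNIV. of_real (l i))"
proof -
  have "det U * det (mat_adj U) = 1"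
    using assms by (metis det_I det_mul unitary_mat_def)
  then show ?thesis by (simp add: udiag_def det_mul det_diag_mat mult_ac)
qed

text \<open>\<open>mat_fun\<close> picks some diagonalization, so the value has to be independent of
  the choice. For two diagonalizations, \<open>mat_adj V ** U\<close> intertwines the diagonal
  matrices: its entry at \<open>i\<close>, \<open>j\<close> vanishes unless
  \<open>l j = k i\<close>. Hence it also intertwines the diagonals after \<open>f\<close> is
  applied.\<close>

lemma mat_fun_udiag:
  assumes U: "unitary_mat U"
  shows "mat_fun f (udiag U l) = udiag U (\<lambda>i. f (l i))"
proof -
  have uniq: "udiag V (\<lambda>i. f (k i)) = udiag U (\<lambda>i. f (l i))"
    if V: "unitary_mat V" and eq: "udiag U l = udiag V k" for V k
  proof -
    define W where "W = mat_adj V ** U"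
    have "W ** diag_mat (\<lambda>i. of_real (l i)) = mat_adj V ** udiag U l ** U"
      using U by (simp add: W_def udiag_def unitary_mat_def flip: matrix_mul_assoc)
    also have "\<dots> = diag_mat (\<lambda>i. of_real (k i)) ** W"
      unfolding eq W_def using V by (simp add: udiag_def unitary_mat_def matrix_mul_assoc)
    finally have comm: "W $ i $ j * of_real (l j) = of_real (k i) * W $ i $ j" for i j
      by (simp add: vec_eq_iff diag_mat_left diag_mat_right)
    have zero_or: "W $ i $ j = 0 \<or> l j = k i" for i j
      using comm[of i j] by (simp add: mult.commute)
    have "W $ i $ j * of_real (f (l j)) = of_real (f (k i)) * W $ i $ j" for i j
      using zero_or[of i j] by (auto simp: mult.commute)
    then have "W ** diag_mat (\<lambda>i. of_real (f (l i))) = diag_mat (\<lambda>i. of_real (f (k i))) ** W"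
      by (simp add: vec_eq_iff diag_mat_left diag_mat_right)
    then have "V ** (W ** diag_mat (\<lambda>i. of_real (f (l i)))) ** mat_adj U
             = V ** (diag_mat (\<lambda>i. of_real (f (k i))) ** W) ** mat_adj U" by simp
    moreover have "V ** (W ** diag_mat (\<lambda>i. of_real (f (l i)))) ** mat_adj U = udiag U (\<lambda>i. f (l i))"
      using V by (simp add: W_def udiag_def unitary_mat_def matrix_mul_assoc)
    moreover have "V ** (diag_mat (\<lambda>i. of_real (f (k i))) ** W) ** mat_adj U = udiag V (\<lambda>i. f (k i))"
      using U by (simp add: W_def udiag_def unitary_mat_def flip: matrix_mul_assoc)
    ultimately show ?thesis by simp
  qed
  show ?thesis
    unfolding mat_fun_def udiag_def[symmetric]
  proof (rule some_equality)
    show "\<exists>V k. unitary_mat V \<and> udiag U l = udiag V k \<and>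
            udiag U (\<lambda>i. f (l i)) = udiag V (\<lambda>i. f (k i))"
      using U by blast
  qed (use uniq in blast)
qed

section \<open>Spectral theorem\<close>

text \<open>Complex orthogonality to \<open>v j\<close> amounts to real orthogonality to both
  \<open>v j\<close> and \<open>\<i> *s v j\<close>. These are at most \<open>2 * card J\<close>
  vectors in a space of real dimension \<open>2 * CARD('n)\<close>.\<close>

lemma exists_orthogonal_unit:
  fixes v :: "'n::finite \<Rightarrow> complex^'n"
  assumes "card J < CARD('n)"
  shows "\<exists>x. norm x = 1 \<and> (\<forall>j\<in>J. cip (v j) x = 0)"
proof -
  define S where "S = v ` J \<union> (\<lambda>j. \<i> *s v j) ` J"
  have J: "finite J" by simp
  have "dim S \<le> card S" using J by (intro dim_le_card') (simp add: S_def)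
  also have "\<dots> \<le> card (v ` J) + card ((\<lambda>j. \<i> *s v j) ` J)"
    unfolding S_def by (rule card_Un_le)
  also have "\<dots> \<le> card J + card J"
    by (intro add_mono card_image_le J)
  also have "\<dots> < DIM(complex^'n)" using assms by simp
  finally obtain x :: "complex^'n" where x: "x \<noteq> 0" "\<And>y. y \<in> span S \<Longrightarrow> orthogonal x y"
    by (rule orthogonal_to_subspace_exists) blast
  have "cip (v j) x = 0" if "j \<in> J" for j
  proof (rule complex_eqI)
    have "v j \<in> span S" "\<i> *s v j \<in> span S"
      using that by (auto simp: S_def intro!: span_base)
    then have "inner (v j) x = 0" "inner (\<i> *s v j) x = 0"
      using x(2) by (metis inner_commute orthogonal_def)+
    then show "Re (cip (v j) x) = Re 0" "Im (cip (v j) x) = Im 0"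
      by (simp_all add: cip_scale_left flip: Re_cip_eq_inner)
  qed
  then have "norm ((1 / norm x) *\<^sub>R x) = 1 \<and> (\<forall>j\<in>J. cip (v j) ((1 / norm x) *\<^sub>R x) = 0)"
    using x(1) by (simp only: cip_scaleR_right) simp
  then show ?thesis by blast
qed

lemma hermitian_cip: "hermitian A \<Longrightarrow> cip x (A *v y) = cip (A *v x) y"
  by (simp add: cip_adj hermitian_def)

text \<open>The next eigenvector maximizes the quadratic form on the unit sphere of the orthogonal
  complement of those already found.\<close>

lemma hermitian_orthonormal_eigenvectors:
  fixes A :: "complex^'n::finite^'n"
  assumes A: "hermitian A" and "finite J"
  shows "\<exists>(v :: 'n \<Rightarrow> complex^'n) l. (\<forall>i\<in>J. \<forall>j\<in>J. cip (v i) (v j) = (if i = j then 1 else 0)) \<and>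
           (\<forall>i\<in>J. A *v v i = of_real (l i) *s v i)"
  using \<open>finite J\<close>
proof (induction J rule: finite_induct)
  case empty
  show ?case by simp
next
  case (insert k J)
  then obtain v :: "'n \<Rightarrow> complex^'n" and l where
    v: "\<And>i j. i \<in> J \<Longrightarrow> j \<in> J \<Longrightarrow> cip (v i) (v j) = (if i = j then 1 else 0)"
      "\<And>i. i \<in> J \<Longrightarrow> A *v v i = of_real (l i) *s v i" by blast
  define W where "W = {x. \<forall>j\<in>J. cip (v j) x = 0}"
  define f where "f x = Re (cip x (A *v x))" for x
  have "card (insert k J) \<le> CARD('n)" by (rule card_mono) auto
  then have "card J < CARD('n)" using insert by simp
  from exists_orthogonal_unit[OF this, of v] have ne: "W \<inter> sphere 0 1 \<noteq> {}"
    by (auto simp: W_def)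
  have "W = (\<Inter>j\<in>J. {x. cip (v j) x = 0})" by (auto simp: W_def)
  moreover have "closed (\<Inter>j\<in>J. {x. cip (v j) x = 0})"
    unfolding cip_def by (intro closed_INT ballI closed_Collect_eq continuous_intros)
  ultimately have "compact (W \<inter> sphere 0 1)"
    by (simp add: closed_Int_compact)
  moreover have "continuous_on (W \<inter> sphere 0 1) f"
    unfolding f_def cip_def matrix_vector_mult_def vec_lambda_beta by (intro continuous_intros)
  ultimately obtain z where "z \<in> W \<inter> sphere 0 1" and max0: "\<forall>y\<in>W \<inter> sphere 0 1. f y \<le> f z"
    using continuous_attains_sup[of "W \<inter> sphere 0 1" f] ne by blast
  then have z: "z \<in> W" "norm z = 1" by auto
  have max: "f y \<le> f z" if "y \<in> W" "norm y = 1" for y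
    using max0 that by simp
  have f_le: "f y \<le> f z * (norm y)\<^sup>2" if "y \<in> W" for y
  proof (cases "y = 0")
    case False
    have "(1 / norm y) *\<^sub>R y \<in> W" using that by (simp only: W_def cip_scaleR_right mem_Collect_eq) simp
    with False have "f ((1 / norm y) *\<^sub>R y) \<le> f z" by (intro max) auto
    moreover have "f y = (norm y)\<^sup>2 * f ((1 / norm y) *\<^sub>R y)"
    proof -
      have "f (c *\<^sub>R y) = c\<^sup>2 * f y" for c
        by (simp add: f_def matrix_vec_scaleR cip_scaleR_left cip_scaleR_right power2_eq_square)
      then show ?thesis using False by (simp add: power_divide)
    qed
    ultimately show ?thesis using False by (simp add: mult.commute mult_left_mono)
  qed (simp add: f_def)
  \<comment> \<open>The residual of the eigenvalue equation for \<open>z\<close>. It lies in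
    \<open>W\<close> because \<open>A\<close> is hermitian and the \<open>v j\<close> are
    eigenvectors orthogonal to \<open>z\<close>.\<close>
  define w where "w = A *v z - of_real (f z) *s z"
  have wW: "w \<in> W"
    unfolding W_def w_def using z(1) v(2)
    by (auto simp: cip_diff_right cip_scale_right hermitian_cip[OF A] cip_scale_left W_def)
  have "w = 0"
  proof -
    define C where "C = f z * (norm w)\<^sup>2 - f w"
    \<comment> \<open>First variation at the maximizer \<open>z\<close> in direction
      \<open>w\<close>: the terms linear in \<open>t\<close> combine to the left side, and the
      quadratic ones to the right side.\<close>
    have key: "2 * t * (norm w)\<^sup>2 \<le> t\<^sup>2 * C" for t :: real
    proof -
      have sw: "of_real t *s w = t *\<^sub>R w"
        by (simp add: vec_eq_iff) (simp add: scaleR_conv_of_real)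
      have "z + of_real t *s w \<in> W"
        using z(1) wW by (simp add: W_def cip_add_right cip_scale_right)
      from f_le[OF this] have "f (z + of_real t *s w) \<le> f z * (norm (z + of_real t *s w))\<^sup>2" .
      moreover have "f (z + of_real t *s w) = f z + 2 * t * Re (cip w (A *v z)) + t\<^sup>2 * f w"
        using arg_cong[OF cip_commute[of "A *v w" z], of Re]
        by (simp add: f_def matrix_vector_right_distrib cip_add_left cip_add_right vector_scalar_commute
            cip_scale_left cip_scale_right hermitian_cip[OF A, of z w] cip_commute[of "A *v z" w]
            power2_eq_square algebra_simps)
      moreover have "(norm (z + of_real t *s w))\<^sup>2 = 1 + 2 * t * Re (cip w z) + t\<^sup>2 * (norm w)\<^sup>2"
        unfolding cip_self_Re[symmetric]
        using z(2) cip_self_Re[of z] arg_cong[OF cip_commute[of z w], of Re]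
        by (simp add: cip_add_left cip_add_right cip_scale_left cip_scale_right
            power2_eq_square algebra_simps)
      ultimately have le: "f z + 2 * t * Re (cip w (A *v z)) + t\<^sup>2 * f w
          \<le> f z * (1 + 2 * t * Re (cip w z) + t\<^sup>2 * (norm w)\<^sup>2)" by simp
      have "(norm w)\<^sup>2 = Re (cip w (A *v z)) - f z * Re (cip w z)"
        unfolding cip_self_Re[symmetric] by (subst (2) w_def) (simp add: cip_diff_right cip_scale_right)
      then have "2 * t * (norm w)\<^sup>2 = 2 * t * Re (cip w (A *v z)) - 2 * t * (f z * Re (cip w z))"
        by (simp add: right_diff_distrib)
      with le show ?thesis by (simp add: C_def distrib_left right_diff_distrib mult_ac)
    qed
    have "2 * a \<le> 0" if "a = (norm w)\<^sup>2" for a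
    proof (rule ccontr)
      assume "\<not> 2 * a \<le> 0"
      then have a: "a > 0" by simp
      \<comment> \<open>Small enough that \<open>t * C \<le> a\<close>, which contradicts
        \<open>2 * a \<le> t * C\<close>.\<close>
      define t where "t = a / (\<bar>C\<bar> + 1)"
      have t: "t > 0" using a by (simp add: t_def)
      have "2 * a \<le> t * C"
        using key[of t] t that by (simp add: power2_eq_square mult.assoc)
      also have "\<dots> \<le> t * (\<bar>C\<bar> + 1)" using t by (intro mult_left_mono) auto
      also have "\<dots> = a" by (simp add: t_def)
      finally show False using a by simp
    qed
    then show ?thesis by (metis mult_le_0_iff norm_eq_zero power_eq_0_iff not_numeral_le_zero
          order_antisym zero_le_power2)
  qed
  then have eig: "A *v z = of_real (f z) *s z" by (simp add: w_def)
  have zz: "cip z z = 1" using z(2) by (simp add: cip_self)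
  have vz: "cip (v j) z = 0" "cip z (v j) = 0" if "j \<in> J" for j
    using z(1) that cip_commute[of z "v j"] by (auto simp: W_def)
  show ?case
    by (rule exI[of _ "v(k := z)"], rule exI[of _ "l(k := f z)"])
       (use insert(2) v eig zz vz in auto)
qed

lemma spectral_hermitian:
  fixes A :: "complex^'n::finite^'n"
  assumes "hermitian A"
  obtains U l where "unitary_mat U" "A = udiag U l"
proof -
  obtain v :: "'n \<Rightarrow> complex^'n" and l where
    v: "\<And>i j. cip (v i) (v j) = (if i = j then 1 else 0)"
      "\<And>i. A *v v i = of_real (l i) *s v i"
    using hermitian_orthonormal_eigenvectors[OF assms, of UNIV] by auto
  define U where "U = (\<chi> i j. v j $ i)"
  have "(mat_adj U ** U) $ i $ j = mat 1 $ i $ j" for i j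
    using v(1)[of i j] by (simp add: U_def mat_adj_def matrix_matrix_mult_def cip_def mat_def)
  then have UU: "mat_adj U ** U = mat 1" by (simp add: vec_eq_iff)
  then have U: "unitary_mat U" by (simp add: unitary_mat_def matrix_left_right_inverse)
  have "(A ** U) $ i $ j = (U ** diag_mat (\<lambda>i. of_real (l i))) $ i $ j" for i j
    using arg_cong[OF v(2)[of j], of "\<lambda>x. x $ i"]
    by (simp add: diag_mat_right) (simp add: U_def matrix_matrix_mult_def matrix_vector_mult_def mult.commute)
  then have "A ** U = U ** diag_mat (\<lambda>i. of_real (l i))" by (simp add: vec_eq_iff)
  then have "A = udiag U l"
    using U by (metis matrix_mul_assoc matrix_mul_rid udiag_def unitary_mat_def)
  with U show ?thesis by (rule that)
qed

text \<open>Polarization: the form at \<open>x + c *s y\<close> is real for \<open>c = 1\<close> and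
  \<open>c = \<i>\<close>, which fixes both parts of \<open>cip x (A *v y)\<close>. Since
  \<open>pd\<close> and \<open>psd\<close> speak only of the quadratic form, this opens the spectral
  theorem to them.\<close>

lemma hermitian_if_real_form:
  assumes "\<And>x. Im (cip x (A *v x)) = 0"
  shows "hermitian A"
proof -
  have "cip x (A *v y) = cip x (mat_adj A *v y)" for x y
  proof -
    have "Im (c * cip x (A *v y) + cnj c * cip y (A *v x)) = 0" for c
      using assms[of "x + c *s y"] assms[of x] assms[of y]
      by (simp add: matrix_vector_right_distrib cip_add_left cip_add_right
          vector_scalar_commute cip_scale_left cip_scale_right algebra_simps)
    from this[of 1] this[of \<i>] have "cip x (A *v y) = cnj (cip y (A *v x))"
      by (simp add: complex_eq_iff)
    also have "\<dots> = cip x (mat_adj A *v y)"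
      by (metis cip_adj cip_commute)
    finally show ?thesis .
  qed
  then have "A *v y = mat_adj A *v y" for y
    by (metis cip_axis vec_eq_iff)
  then show ?thesis by (metis hermitian_def matrix_eq)
qed

lemma pd_hermitian: "pd A \<Longrightarrow> hermitian A"
  by (rule hermitian_if_real_form) (metis cip_zero(1) pd_def qform_cip zero_complex.sel(2))

lemma psd_hermitian: "psd A \<Longrightarrow> hermitian A"
  by (rule hermitian_if_real_form) (simp add: psd_def qform_cip)

section \<open>Positive semidefinite block matrices\<close>

text \<open>\<open>psd_block P R Q\<close> says that the block matrix with rows \<open>P, R\<close> and \<open>R\<^sup>*, Q\<close> is positive
  semidefinite.\<close>

definition psd_block :: "complex^'n^'n \<Rightarrow> complex^'m^'n \<Rightarrow> complex^'m^'m \<Rightarrow> bool" where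
  "psd_block P R Q \<longleftrightarrow> (\<forall>u v. 0 \<le> Re (cip u (P *v u)) + 2 * Re (cip u (R *v v)) + Re (cip v (Q *v v)))"

lemma psd_block_add: "psd_block P R Q \<Longrightarrow> psd_block P' R' Q' \<Longrightarrow> psd_block (P + P') (R + R') (Q + Q')"
  unfolding psd_block_def
proof (intro allI)
  fix u v
  assume "\<forall>u v. 0 \<le> Re (cip u (P *v u)) + 2 * Re (cip u (R *v v)) + Re (cip v (Q *v v))"
    "\<forall>u v. 0 \<le> Re (cip u (P' *v u)) + 2 * Re (cip u (R' *v v)) + Re (cip v (Q' *v v))"
  from this[THEN spec, THEN spec, of u v]
  show "0 \<le> Re (cip u ((P + P') *v u)) + 2 * Re (cip u ((R + R') *v v)) + Re (cip v ((Q + Q') *v v))"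
    by (simp add: matrix_add_vec cip_add_right)
qed

lemma cip_congr: "cip x ((mat_adj X ** M ** Y) *v y) = cip (X *v x) (M *v (Y *v y))"
  by (simp add: cip_adj[of x "mat_adj X"] flip: matrix_vector_mul_assoc)

text \<open>Congruence by the block diagonal matrix of \<open>X\<close> and
  \<open>Y\<close>.\<close>

lemma psd_block_congr:
  "psd_block P R Q \<Longrightarrow> psd_block (mat_adj X ** P ** X) (mat_adj X ** R ** Y) (mat_adj Y ** Q ** Y)"
  by (simp add: psd_block_def cip_congr)

lemma psd_block_scale:
  assumes "psd_block P R Q"
  shows "psd_block ((a * a) *\<^sub>R P) ((a * b) *\<^sub>R R) ((b * b) *\<^sub>R Q)"
  unfolding psd_block_def
proof (intro allI)
  fix u v
  show "0 \<le> Re (cip u ((a * a) *\<^sub>R P *v u)) + 2 * Re (cip u ((a * b) *\<^sub>R R *v v))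
      + Re (cip v ((b * b) *\<^sub>R Q *v v))"
    using assms[unfolded psd_block_def, THEN spec, THEN spec, of "a *\<^sub>R u" "b *\<^sub>R v"]
    by (simp add: matrix_vec_scaleR scaleR_matrix_vec cip_scaleR_left cip_scaleR_right mult_ac)
qed

lemma psd_block_mono:
  assumes "psd_block P R Q" "\<And>x. Re (cip x (P *v x)) \<le> Re (cip x (P' *v x))"
    "\<And>x. Re (cip x (Q *v x)) \<le> Re (cip x (Q' *v x))"
  shows "psd_block P' R Q'"
  unfolding psd_block_def
proof (intro allI)
  fix u v
  show "0 \<le> Re (cip u (P' *v u)) + 2 * Re (cip u (R *v v)) + Re (cip v (Q' *v v))"
    using assms(1)[unfolded psd_block_def, THEN spec, THEN spec, of u v] assms(2)[of u] assms(3)[of v]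
    by linarith
qed

text \<open>The block form at \<open>u\<close>, \<open>v\<close> is the form of \<open>E\<close> at
  \<open>a *\<^sub>R u + b *\<^sub>R v\<close>. All blocks below arise from such ones by sums,
  scalings, congruences and enlarging the diagonal.\<close>

lemma psd_block_scaled_copies:
  assumes E: "hermitian E" and pos: "\<And>x. 0 \<le> Re (cip x (E *v x))"
  shows "psd_block ((a * a) *\<^sub>R E) ((a * b) *\<^sub>R E) ((b * b) *\<^sub>R E)"
  unfolding psd_block_def
proof (intro allI)
  fix u v
  have "Re (cip v (E *v u)) = Re (cip u (E *v v))"
    using E by (metis hermitian_cip cip_commute cnj.simps(1))
  then show "0 \<le> Re (cip u ((a * a) *\<^sub>R E *v u)) + 2 * Re (cip u ((a * b) *\<^sub>R E *v v))
      + Re (cip v ((b * b) *\<^sub>R E *v v))"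
    using pos[of "a *\<^sub>R u + b *\<^sub>R v"]
    by (simp add: matrix_vector_right_distrib matrix_vec_scaleR scaleR_matrix_vec
        cip_add_left cip_add_right cip_scaleR_left cip_scaleR_right algebra_simps)
qed

section \<open>Determinant inequalities\<close>

text \<open>The eigenvalues of \<open>mat_adj K ** K\<close> are the squared norms of
  \<open>K\<close> on unit eigenvectors, hence at most 1, and their product is the squared modulus
  of \<open>det K\<close>.\<close>

lemma cmod_det_contraction_le_1:
  fixes K :: "complex^'n::finite^'n"
  assumes "\<And>v. norm (K *v v) \<le> norm v"
  shows "cmod (det K) \<le> 1"
proof -
  have "hermitian (mat_adj K ** K)" by (simp add: hermitian_def mat_adj_mul)
  then obtain V k where V: "unitary_mat V" and eq: "mat_adj K ** K = udiag V k"
    by (rule spectral_hermitian)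
  have k: "0 \<le> k i \<and> k i \<le> 1" for i
  proof -
    define e :: "complex^'n" where "e = V *v axis i 1"
    have "complex_of_real (k i) = cip e ((mat_adj K ** K) *v e)"
      unfolding eq e_def by (rule udiag_eigenvector(1)[OF V, symmetric])
    also have "\<dots> = of_real ((norm (K *v e))\<^sup>2)"
      by (simp add: cip_adj[of e "mat_adj K"] cip_self flip: matrix_vector_mul_assoc)
    finally have "k i = (norm (K *v e))\<^sup>2" by (simp only: of_real_eq_iff)
    moreover have "(norm e)\<^sup>2 = 1"
      using udiag_eigenvector(1)[OF V, of i "\<lambda>_. 1"] cip_self_Re[of e] V
      by (simp add: udiag_one e_def)
    ultimately show ?thesis using assms[of e] by (metis power_mono norm_ge_zero zero_le_power2)
  qed
  have "(cmod (det K))\<^sup>2 = cmod (det (mat_adj K ** K))"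
    by (simp add: det_mul det_mat_adj norm_mult power2_eq_square)
  also have "\<dots> = (\<Prod>i\<in>UNIV. \<bar>k i\<bar>)" by (simp add: eq det_udiag[OF V] flip: prod_norm)
  also have "\<dots> \<le> 1" using k by (intro prod_le_1) auto
  finally show ?thesis by (simp add: power2_le_iff_abs_le abs_square_le_1)
qed

lemma hermitian_pd_udiag:
  fixes P :: "complex^'n::finite^'n"
  assumes "hermitian P" "\<And>x. x \<noteq> 0 \<Longrightarrow> 0 < Re (cip x (P *v x))"
  obtains V p where "unitary_mat V" "P = udiag V p" "\<forall>i. p i > 0"
proof -
  obtain V p where V: "unitary_mat V" "P = udiag V p" using assms(1) by (rule spectral_hermitian)
  have "p i > 0" for i
    using assms(2)[OF udiag_eigenvector(2)[OF V(1), of i]]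
    by (simp add: V(2) udiag_eigenvector(1)[OF V(1)])
  with V show ?thesis using that by blast
qed

text \<open>With \<open>S\<close> and \<open>T\<close> the inverse square roots of \<open>P\<close> and \<open>Q\<close>, the matrix \<open>S R T\<close> is a contraction.\<close>

lemma cmod_det_psd_block_le:
  fixes P R Q :: "complex^'n::finite^'n"
  assumes "psd_block P R Q" "hermitian P" "\<And>x. x \<noteq> 0 \<Longrightarrow> 0 < Re (cip x (P *v x))"
    "hermitian Q" "\<And>x. x \<noteq> 0 \<Longrightarrow> 0 < Re (cip x (Q *v x))"
  shows "(cmod (det R))\<^sup>2 \<le> cmod (det P) * cmod (det Q)"
proof -
  obtain V p where V: "unitary_mat V" "P = udiag V p" "\<forall>i. p i > 0"
    by (rule hermitian_pd_udiag[OF assms(2,3)])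
  obtain W q where W: "unitary_mat W" "Q = udiag W q" "\<forall>i. q i > 0"
    by (rule hermitian_pd_udiag[OF assms(4,5)])
  define S where "S = udiag V (\<lambda>i. 1 / sqrt (p i))"
  define T where "T = udiag W (\<lambda>i. 1 / sqrt (q i))"
  define K where "K = S ** R ** T"
  have SPS: "mat_adj S ** P ** S = mat 1"
  proof -
    have "1 / sqrt (p i) * p i * (1 / sqrt (p i)) = 1" for i
      using spec[OF V(3), of i] by (simp add: field_simps)
    then show ?thesis
      by (simp only: S_def V(2) mat_adj_udiag udiag_mul[OF V(1)] udiag_one[OF V(1)])
  qed
  have TQT: "mat_adj T ** Q ** T = mat 1"
  proof -
    have "1 / sqrt (q i) * q i * (1 / sqrt (q i)) = 1" for i
      using spec[OF W(3), of i] by (simp add: field_simps)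
    then show ?thesis
      by (simp only: T_def W(2) mat_adj_udiag udiag_mul[OF W(1)] udiag_one[OF W(1)])
  qed
  have "psd_block (mat 1) K (mat 1)"
    using psd_block_congr[OF assms(1), of S T] unfolding SPS TQT
    by (simp add: K_def S_def mat_adj_udiag)
  then have K: "0 \<le> Re (cip u u) + 2 * Re (cip u (K *v v)) + Re (cip v v)" for u v
    by (simp add: psd_block_def)
  \<comment> \<open>The choice \<open>u = - (K *v v)\<close> minimizes the block form in
    \<open>u\<close>.\<close>
  have "norm (K *v v) \<le> norm v" for v
  proof -
    have "cip (- (K *v v)) y = - cip (K *v v) y" for y
      using cip_scaleR_left[of "-1" "K *v v" y] by simp
    with K[of "- (K *v v)" v] cip_self_Re[of "- (K *v v)"] have "(norm (K *v v))\<^sup>2 \<le> (norm v)\<^sup>2"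
      by (simp add: cip_self_Re)
    then show ?thesis by (rule power2_le_imp_le) simp
  qed
  then have "cmod (det K) \<le> 1" by (rule cmod_det_contraction_le_1)
  then have K1: "(cmod (det K))\<^sup>2 \<le> 1" by (simp add: power_le_one)
  have S1: "(cmod (det S))\<^sup>2 * cmod (det P) = 1"
    using arg_cong[OF SPS, of "\<lambda>M. cmod (det M)"]
    by (simp add: det_mul det_mat_adj norm_mult power2_eq_square mult_ac)
  have T1: "(cmod (det T))\<^sup>2 * cmod (det Q) = 1"
    using arg_cong[OF TQT, of "\<lambda>M. cmod (det M)"]
    by (simp add: det_mul det_mat_adj norm_mult power2_eq_square mult_ac)
  \<comment> \<open>Multiplying by two factors equal to 1 assembles \<open>det K\<close> out of
    \<open>det S\<close>, \<open>det R\<close> and \<open>det T\<close>.\<close>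
  have "(cmod (det R))\<^sup>2 = (cmod (det R))\<^sup>2 * ((cmod (det S))\<^sup>2 * cmod (det P)) * ((cmod (det T))\<^sup>2 * cmod (det Q))"
    unfolding S1 T1 by simp
  also have "\<dots> = (cmod (det K))\<^sup>2 * (cmod (det P) * cmod (det Q))"
    unfolding K_def det_mul norm_mult power_mult_distrib by (simp only: mult_ac)
  also have "\<dots> \<le> 1 * (cmod (det P) * cmod (det Q))"
    by (intro mult_right_mono K1) simp
  finally show ?thesis by simp
qed

text \<open>Sylvester's identity: \<open>X\<close> intertwines the two matrices, and
  \<open>det X\<close> cancels.\<close>

lemma det_one_plus_swap:
  fixes X Y :: "complex^'n::finite^'n"
  assumes "det X \<noteq> 0"
  shows "det (mat 1 + X ** Y) = det (mat 1 + Y ** X)"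
proof -
  have "(mat 1 + X ** Y) ** X = X ** (mat 1 + Y ** X)"
    by (simp add: matrix_add_ldistrib matrix_add_rdistrib matrix_mul_assoc)
  from arg_cong[OF this, of det] assms show ?thesis by (simp add: det_mul)
qed

lemma cip_udiag_conj:
  "cip x ((udiag U l ** M ** udiag U l) *v y) = cip (udiag U l *v x) (M *v (udiag U l *v y))"
  using cip_congr[of x "udiag U l"] by (simp add: mat_adj_udiag)

lemma cip_udiag_nonneg: "(\<And>i. 0 \<le> l i) \<Longrightarrow> 0 \<le> Re (cip x (udiag U l *v x))"
  by (simp add: qform_udiag sum_nonneg)

text \<open>Conjugating by \<open>D\<close> amounts, up to a cyclic shift inside the determinant, to compressing
  \<open>D\<^sup>2 \<le> 1\<close> by the square root of \<open>C\<close>.\<close>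

lemma cmod_det_one_plus_conj_le:
  fixes V :: "complex^'n::finite^'n"
  assumes V: "unitary_mat V" and c: "\<And>i. c i > 0" and w: "\<And>i. 0 < w i" "\<And>i. w i \<le> 1"
  defines "D \<equiv> udiag (mat 1) (\<lambda>i. sqrt (w i))"
  shows "cmod (det (mat 1 + D ** udiag V c ** D)) \<le> (\<Prod>i\<in>UNIV. 1 + c i)"
proof -
  define S where "S = udiag V (\<lambda>i. sqrt (c i))"
  define C where "C = udiag V c"
  define DD where "DD = udiag (mat 1 :: complex^'n^'n) w"
  have DD: "D ** D = DD"
    using w(1) by (simp add: D_def DD_def udiag_mul[OF unitary_mat_1] less_imp_le)
  have SS: "S ** S = C"
    using c by (simp add: S_def C_def udiag_mul[OF V] less_imp_le)
  have detD: "det D \<noteq> 0"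
    using w(1) by (simp add: D_def det_udiag[OF unitary_mat_1] less_imp_neq[THEN not_sym])
  have detS: "det S \<noteq> 0"
    using c by (simp add: S_def det_udiag[OF V] less_imp_neq[THEN not_sym])
  define X where "X = mat 1 + S ** DD ** S"
  define Y where "Y = mat 1 + C"
  have Y_eq: "Y = udiag V (\<lambda>i. 1 + c i)"
    by (simp add: Y_def C_def udiag_one[OF V, symmetric] udiag_add)
  have "det (mat 1 + D ** C ** D) = det (mat 1 + D ** (C ** D))"
    by (simp add: matrix_mul_assoc)
  also have "\<dots> = det (mat 1 + (C ** D) ** D)" by (rule det_one_plus_swap[OF detD])
  also have "\<dots> = det (mat 1 + S ** (S ** DD))"
    by (simp add: DD[symmetric] SS[symmetric] matrix_mul_assoc)
  also have "\<dots> = det (mat 1 + (S ** DD) ** S)" by (rule det_one_plus_swap[OF detS])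
  finally have det_eq: "det (mat 1 + D ** C ** D) = det X" by (simp add: X_def)
  have qX: "Re (cip x (X *v x)) = (norm x)\<^sup>2 + Re (cip (S *v x) (DD *v (S *v x)))" for x
    by (simp add: X_def S_def matrix_add_vec cip_add_right cip_udiag_conj cip_self_Re)
  have X_nonneg: "0 \<le> Re (cip x (X *v x))" for x
    unfolding qX DD_def using w(1) by (intro add_nonneg_nonneg cip_udiag_nonneg) (auto intro: less_imp_le)
  have X_le: "Re (cip x (X *v x)) \<le> Re (cip x (Y *v x))" for x
  proof -
    have "Re (cip (S *v x) (DD *v (S *v x))) \<le> Re (cip (S *v x) (udiag (mat 1) (\<lambda>_. 1) *v (S *v x)))"
      unfolding DD_def by (rule qform_udiag_mono) (rule w(2))
    also have "\<dots> = Re (cip x (C *v x))"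
      unfolding SS[symmetric] matrix_vector_mul_assoc[symmetric] cip_adj[of x S "S *v x"]
      by (simp add: udiag_one[OF unitary_mat_1] S_def mat_adj_udiag)
    finally show ?thesis
      unfolding qX by (simp add: Y_def matrix_add_vec cip_add_right cip_self_Re)
  qed
  have X_herm: "hermitian X"
    by (simp add: X_def hermitian_def mat_adj_add mat_adj_mul S_def DD_def mat_adj_udiag matrix_mul_assoc)
  have Y_pos: "0 < Re (cip x (Y *v x))" if "x \<noteq> 0" for x
  proof -
    have "0 < Re (cip x (udiag V (\<lambda>_. 1) *v x))"
      using that by (simp add: udiag_one[OF V] cip_self_Re)
    also have "\<dots> \<le> Re (cip x (Y *v x))"
      unfolding Y_eq by (rule qform_udiag_mono) (use less_imp_le[OF c] in simp)
    finally show ?thesis .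
  qed
  \<comment> \<open>The block inequality also yields monotonicity of the determinant: the block with
    all entries \<open>X\<close> stays positive when its diagonal is enlarged to
    \<open>Y\<close>.\<close>
  have "psd_block X X X" using psd_block_scaled_copies[OF X_herm X_nonneg, of 1 1] by simp
  then have "psd_block Y X Y" by (rule psd_block_mono) (rule X_le)+
  then have "(cmod (det X))\<^sup>2 \<le> cmod (det Y) * cmod (det Y)"
    by (rule cmod_det_psd_block_le) (use Y_pos hermitian_udiag in \<open>auto simp: Y_eq\<close>)
  then have "(cmod (det X))\<^sup>2 \<le> (cmod (det Y))\<^sup>2" by (simp only: power2_eq_square)
  then have "cmod (det X) \<le> cmod (det Y)" by (rule power2_le_imp_le) simp
  also have "cmod (det Y) = (\<Prod>i\<in>UNIV. 1 + c i)"
    unfolding Y_eq det_udiag[OF V] of_real_prod[symmetric] norm_of_real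
    by (intro abs_of_nonneg prod_nonneg) (simp add: add_nonneg_nonneg less_imp_le[OF c])
  finally show ?thesis using det_eq by (simp add: C_def)
qed

section \<open>Truncated products of eigenvalues\<close>

text \<open>The determinant bound has to see only the eigenvalues \<open>r i\<close> above 1.
  Compressing the block by the diagonal matrix \<open>D\<close> and adding copies of
  \<open>G\<close>, with \<open>D ** D + G = mat 1\<close>, replaces \<open>r i\<close> by
  \<open>1 + w i * (r i - 1)\<close>. Weight 1 keeps an eigenvalue, and a small weight moves it
  close to 1.\<close>

lemma prod_max_one_psd_block_diag_le:
  fixes V W :: "complex^'n::finite^'n"
  assumes V: "unitary_mat V" and W: "unitary_mat W"
    and psd_block: "psd_block (udiag V p) (udiag (mat 1) r) (udiag W q)"
  shows "(\<Prod>i\<in>UNIV. max (r i) 1)\<^sup>2 \<le> (\<Prod>i\<in>UNIV. max (p i) 1) * (\<Prod>i\<in>UNIV. max (q i) 1)"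
proof -
  have key: "(\<Prod>i\<in>UNIV. 1 + w i * (r i - 1))\<^sup>2
      \<le> (\<Prod>i\<in>UNIV. max (p i) 1 + d) * (\<Prod>i\<in>UNIV. max (q i) 1 + d)"
    if w: "\<And>i. 0 < w i" "\<And>i. w i \<le> 1" and d: "d > 0" for w d
  proof -
    define D where "D = udiag (mat 1 :: complex^'n^'n) (\<lambda>i. sqrt (w i))"
    define G where "G = udiag (mat 1 :: complex^'n^'n) (\<lambda>i. 1 - w i)"
    \<comment> \<open>An upper bound of the compressed diagonal block, written so that
      \<open>cmod_det_one_plus_conj_le\<close> applies. The summand \<open>d\<close> makes the
      conjugated matrix positive definite.\<close>
    define X where "X V p = mat 1 + D ** udiag V (\<lambda>i. max (p i) 1 + d - 1) ** D"
      for V :: "complex^'n^'n" and p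
    have DG: "D ** D + G = mat 1"
      using w(1) by (simp add: D_def G_def udiag_mul[OF unitary_mat_1] less_imp_le udiag_add udiag_one[OF unitary_mat_1])
    have G: "hermitian G" "\<And>x. 0 \<le> Re (cip x (G *v x))"
      using w(2) by (auto simp: G_def intro!: hermitian_udiag cip_udiag_nonneg)
    have X_le: "Re (cip x ((D ** udiag V p ** D + G) *v x)) \<le> Re (cip x (X V p *v x))"
      if V: "unitary_mat V" for V p x
    proof -
      have X_eq: "X V p = D ** udiag V (\<lambda>i. max (p i) 1 + d) ** D + G"
      proof -
        have "udiag V (\<lambda>i. max (p i) 1 + d) = udiag V (\<lambda>i. max (p i) 1 + d - 1) + mat 1"
          by (simp add: udiag_one[OF V, symmetric] udiag_add)
        then have "D ** udiag V (\<lambda>i. max (p i) 1 + d) ** D + G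
            = D ** udiag V (\<lambda>i. max (p i) 1 + d - 1) ** D + (D ** D + G)"
          by (simp add: matrix_add_ldistrib matrix_add_rdistrib add.assoc)
        then show ?thesis unfolding X_def DG[symmetric] by (simp only: add_ac)
      qed
      show ?thesis
        unfolding X_eq matrix_add_vec cip_add_right plus_complex.sel D_def cip_udiag_conj
        by (intro add_right_mono qform_udiag_mono) (use d in simp)
    qed
    have X_herm: "hermitian (X V p)" for V p
      by (simp add: X_def hermitian_def mat_adj_add mat_adj_mul D_def mat_adj_udiag matrix_mul_assoc)
    have X_pos: "0 < Re (cip x (X V p *v x))" if "x \<noteq> 0" for V p x
    proof -
      have "0 \<le> Re (cip y (udiag V (\<lambda>i. max (p i) 1 + d - 1) *v y))" for y
        by (rule cip_udiag_nonneg) (use d in auto)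
      then show ?thesis
        using that by (simp add: X_def matrix_add_vec cip_add_right D_def cip_udiag_conj cip_self_Re
            add_pos_nonneg)
    qed
    have X_det: "cmod (det (X V p)) \<le> (\<Prod>i\<in>UNIV. max (p i) 1 + d)" if "unitary_mat V" for V p
      using cmod_det_one_plus_conj_le[OF that, of "\<lambda>i. max (p i) 1 + d - 1" w] w d
      by (simp add: X_def D_def add_pos_nonneg less_max_iff_disj max_def)
    define Rw where "Rw = udiag (mat 1 :: complex^'n^'n) (\<lambda>i. 1 + w i * (r i - 1))"
    have Rw: "D ** udiag (mat 1) r ** D + G = Rw"
      using w(1) by (simp add: D_def G_def Rw_def udiag_mul[OF unitary_mat_1] udiag_add algebra_simps less_imp_le)
    have "psd_block (D ** udiag V p ** D + G) (D ** udiag (mat 1) r ** D + G) (D ** udiag W q ** D + G)"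
      using psd_block_add[OF psd_block_congr[OF psd_block, of D D]] psd_block_scaled_copies[OF G, of 1 1]
      by (simp add: D_def mat_adj_udiag)
    then have "psd_block (X V p) Rw (X W q)"
      unfolding Rw by (rule psd_block_mono) (rule X_le[OF V] X_le[OF W])+
    then have "(cmod (det Rw))\<^sup>2 \<le> cmod (det (X V p)) * cmod (det (X W q))"
      by (rule cmod_det_psd_block_le) (use X_herm X_pos in auto)
    also have "\<dots> \<le> (\<Prod>i\<in>UNIV. max (p i) 1 + d) * (\<Prod>i\<in>UNIV. max (q i) 1 + d)"
      using d by (intro mult_mono X_det V W prod_nonneg) auto
    also have "cmod (det Rw) = \<bar>\<Prod>i\<in>UNIV. 1 + w i * (r i - 1)\<bar>"
      unfolding Rw_def det_udiag[OF unitary_mat_1] of_real_prod[symmetric] norm_of_real ..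
    finally show ?thesis by simp
  qed
  show ?thesis
  proof (rule tendsto_le)
    \<comment> \<open>The weight is 1 where \<open>r i > 1\<close> and \<open>d\<close> elsewhere:
      positive for each \<open>d\<close>, as \<open>key\<close> requires, with factors tending to
      \<open>max (r i) 1\<close>.\<close>
    show "((\<lambda>d. (\<Prod>i\<in>UNIV. 1 + (if r i > 1 then 1 else d) * (r i - 1))\<^sup>2) \<longlongrightarrow> (\<Prod>i\<in>UNIV. max (r i) 1)\<^sup>2) (at_right 0)"
    proof (intro tendsto_power tendsto_prod)
      fix i
      have "((\<lambda>d. 1 + d * (r i - 1)) \<longlongrightarrow> 1 + 0 * (r i - 1)) (at_right 0)"
        by (intro tendsto_intros)
      then show "((\<lambda>d. 1 + (if r i > 1 then 1 else d) * (r i - 1)) \<longlongrightarrow> max (r i) 1) (at_right 0)"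
        by (cases "r i > 1") auto
    qed
    have "((\<lambda>d. (\<Prod>i\<in>UNIV. max (p i) 1 + d) * (\<Prod>i\<in>UNIV. max (q i) 1 + d)) \<longlongrightarrow>
        (\<Prod>i\<in>UNIV. max (p i) 1 + 0) * (\<Prod>i\<in>UNIV. max (q i) 1 + 0)) (at_right 0)"
      by (intro tendsto_intros)
    then show "((\<lambda>d. (\<Prod>i\<in>UNIV. max (p i) 1 + d) * (\<Prod>i\<in>UNIV. max (q i) 1 + d)) \<longlongrightarrow>
        (\<Prod>i\<in>UNIV. max (p i) 1) * (\<Prod>i\<in>UNIV. max (q i) 1)) (at_right 0)" by simp
    have "\<forall>\<^sub>F d in at_right (0::real). 0 < d \<and> d < 1"
      by (simp add: eventually_at_right_field) (metis zero_less_one)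
    then show "\<forall>\<^sub>F d in at_right 0. (\<Prod>i\<in>UNIV. 1 + (if r i > 1 then 1 else d) * (r i - 1))\<^sup>2
        \<le> (\<Prod>i\<in>UNIV. max (p i) 1 + d) * (\<Prod>i\<in>UNIV. max (q i) 1 + d)"
      by eventually_elim (rule key; simp)
  qed simp
qed

text \<open>Conjugating all three blocks by \<open>U\<close> makes the middle one diagonal.\<close>

lemma prod_max_one_psd_block_le:
  fixes U V W :: "complex^'n::finite^'n"
  assumes U: "unitary_mat U" and V: "unitary_mat V" and W: "unitary_mat W"
    and psd_block: "psd_block (udiag V p) (udiag U r) (udiag W q)"
  shows "(\<Prod>i\<in>UNIV. max (r i) 1)\<^sup>2 \<le> (\<Prod>i\<in>UNIV. max (p i) 1) * (\<Prod>i\<in>UNIV. max (q i) 1)"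
proof (rule prod_max_one_psd_block_diag_le)
  show "unitary_mat (mat_adj U ** V)" "unitary_mat (mat_adj U ** W)"
    using U V W by (auto intro: unitary_mat_mul unitary_mat_adj)
  have "mat_adj U ** udiag Z l ** U = udiag (mat_adj U ** Z) l" for Z l
    using udiag_conj[of "mat_adj U" Z l] by simp
  moreover have "mat_adj U ** U = mat 1" using U by (simp add: unitary_mat_def)
  ultimately show "psd_block (udiag (mat_adj U ** V) p) (udiag (mat 1) r) (udiag (mat_adj U ** W) q)"
    using psd_block_congr[OF psd_block, of U U] by simp
qed

text \<open>The scaling by \<open>a\<close> and \<open>b\<close> reduces to thresholds equal to one.\<close>

lemma prod_max_psd_block_le:
  fixes U V W :: "complex^'n::finite^'n"
  assumes U: "unitary_mat U" and V: "unitary_mat V" and W: "unitary_mat W"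
    and psd_block: "psd_block (udiag V p) (udiag U r) (udiag W q)" and a: "a > 0" and b: "b > 0"
  shows "(\<Prod>i\<in>UNIV. max (r i / sqrt (a * b)) 1)\<^sup>2 \<le> (\<Prod>i\<in>UNIV. max (p i / a) 1) * (\<Prod>i\<in>UNIV. max (q i / b) 1)"
proof (rule prod_max_one_psd_block_le[OF U V W])
  have "1 / sqrt a * (1 / sqrt a) = 1 / a" "1 / sqrt b * (1 / sqrt b) = 1 / b"
    "1 / sqrt a * (1 / sqrt b) = 1 / sqrt (a * b)"
    using a b by (simp_all add: real_sqrt_mult)
  then show "psd_block (udiag V (\<lambda>i. p i / a)) (udiag U (\<lambda>i. r i / sqrt (a * b))) (udiag W (\<lambda>i. q i / b))"
    using psd_block_scale[OF psd_block, of "1 / sqrt a" "1 / sqrt b"] by (simp add: udiag_scale)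
qed

section \<open>Weak majorization and symmetric norms\<close>

text \<open>Abel summation. The induction carries the sharper lower bound by the last weight times
  the partial sum.\<close>

lemma sum_mult_antimono_nonneg:
  fixes m z :: "nat \<Rightarrow> real"
  assumes m: "\<And>i. i < d \<Longrightarrow> 0 \<le> m i" "\<And>i j. i \<le> j \<Longrightarrow> j < d \<Longrightarrow> m j \<le> m i"
    and z: "\<And>k. k \<le> d \<Longrightarrow> 0 \<le> (\<Sum>j<k. z j)"
  shows "0 \<le> (\<Sum>j<d. m j * z j)"
proof (cases d)
  case (Suc d')
  have "m n * (\<Sum>j<Suc n. z j) \<le> (\<Sum>j<Suc n. m j * z j)" if "n < d" for n
    using that
  proof (induction n)
    case (Suc n)
    have "m (Suc n) * (\<Sum>j<Suc n. z j) \<le> m n * (\<Sum>j<Suc n. z j)"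
      using Suc.prems by (intro mult_right_mono m z) auto
    also have "\<dots> \<le> (\<Sum>j<Suc n. m j * z j)" using Suc by simp
    finally show ?case by (simp add: distrib_left)
  qed simp
  from this[of d'] have "m d' * (\<Sum>j<d. z j) \<le> (\<Sum>j<d. m j * z j)" using Suc by simp
  moreover have "0 \<le> m d' * (\<Sum>j<d. z j)"
    using Suc by (intro mult_nonneg_nonneg m z) auto
  ultimately show ?thesis by simp
qed simp

text \<open>A slope \<open>s\<close> of supporting lines of \<open>h\<close> is non-negative by
  monotonicity and non-decreasing by convexity. So \<open>s (a j)\<close> decreases in
  \<open>j\<close>, and Abel summation applies to \<open>s (a j) * (b j - a j)\<close>, which is at
  most \<open>h (b j) - h (a j)\<close>.\<close>

lemma sum_mono_of_weak_majorization:
  fixes h :: "real \<Rightarrow> real" and a b :: "nat \<Rightarrow> real"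
  assumes h: "convex_on UNIV h" "mono h"
    and a: "\<And>i j. i \<le> j \<Longrightarrow> j < d \<Longrightarrow> a j \<le> a i"
    and le: "\<And>k. k \<le> d \<Longrightarrow> (\<Sum>j<k. a j) \<le> (\<Sum>j<k. b j)"
  shows "(\<Sum>j<d. h (a j)) \<le> (\<Sum>j<d. h (b j))"
proof -
  \<comment> \<open>The witness is the right derivative, as an infimum of difference
    quotients.\<close>
  obtain s where s: "\<And>x y. h x + s x * (y - x) \<le> h y"
  proof
    show "h x + Inf ((\<lambda>t. (h x - h t) / (x - t)) ` ({x<..} \<inter> UNIV)) * (y - x) \<le> h y" for x y
      by (rule convex_le_Inf_differential[OF h(1)]) auto
  qed
  have s_nonneg: "0 \<le> s x" for x
    using s[of x "x - 1"] monoD[OF h(2), of "x - 1" x] by simp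
  have s_mono: "s x \<le> s y" if "x \<le> y" for x y
  proof (cases "x = y")
    case False
    have "(s x - s y) * (y - x) \<le> 0" using s[of x y] s[of y x] by (simp add: algebra_simps)
    then show ?thesis using False that by (simp add: mult_le_0_iff)
  qed simp
  have "0 \<le> (\<Sum>j<d. s (a j) * (b j - a j))"
    by (rule sum_mult_antimono_nonneg) (use s_nonneg s_mono a le in \<open>auto simp: sum_subtractf\<close>)
  also have "\<dots> \<le> (\<Sum>j<d. h (b j) - h (a j))"
    by (intro sum_mono) (use s in \<open>simp add: le_diff_eq add.commute\<close>)
  finally show ?thesis by (simp add: sum_subtractf)
qed

section \<open>Midpoint convexity and weighted means\<close>

text \<open>Subtracting the chord leaves a midpoint convex \<open>f\<close> that vanishes at both
  ends. Were its maximum positive, the midpoint inequality would fail at the leftmost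
  maximizer.\<close>

lemma convex_on_midpoint_continuous:
  fixes h :: "real \<Rightarrow> real"
  assumes cont: "continuous_on UNIV h" and mid: "\<And>x y. h ((x + y) / 2) \<le> (h x + h y) / 2"
  shows "convex_on UNIV h"
proof (rule convex_on_linorderI)
  fix t a b :: real
  assume t: "0 < t" "t < 1" and ab: "a < b"
  define m where "m = (h b - h a) / (b - a)"
  define f where "f x = h x - (h a + (x - a) * m)" for x
  have f_mid: "f x \<le> (f (x - e) + f (x + e)) / 2" for x e
    using mid[of "x - e" "x + e"] by (simp add: f_def algebra_simps)
  have f0: "f a = 0" "f b = 0" using ab by (simp_all add: f_def m_def)
  have contf: "continuous_on {a..b} f"
    unfolding f_def using continuous_on_subset[OF cont] ab by (intro continuous_intros) auto
  obtain z where z: "z \<in> {a..b}" and zmax: "\<And>y. y \<in> {a..b} \<Longrightarrow> f y \<le> f z"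
    using continuous_attains_sup[OF compact_Icc _ contf] ab by auto
  have "f z \<le> 0"
  proof (rule ccontr)
    assume pos: "\<not> f z \<le> 0"
    define Z where "Z = {x \<in> {a..b}. f x = f z}"
    have "closed Z"
      unfolding Z_def using continuous_closed_preimage_constant[OF contf closed_atLeastAtMost] by simp
    moreover have "Z \<noteq> {}" "bdd_below Z" using z by (auto simp: Z_def)
    ultimately have "Inf Z \<in> Z" by (rule closed_contains_Inf[rotated 2])
    define c where "c = Inf Z"
    have c: "c \<in> {a..b}" "f c = f z" using \<open>Inf Z \<in> Z\<close> by (auto simp: c_def Z_def)
    have "c \<noteq> a" "c \<noteq> b" using c f0 pos by auto
    then have cab: "a < c" "c < b" using c(1) by auto
    \<comment> \<open>The largest radius for which both \<open>c - e\<close> and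
      \<open>c + e\<close> stay in the interval.\<close>
    define e where "e = min (c - a) (b - c)"
    have e: "e > 0" "c - e \<in> {a..b}" "c + e \<in> {a..b}" using cab by (auto simp: e_def)
    have "c - e \<notin> Z"
      using cInf_lower[OF _ \<open>bdd_below Z\<close>, of "c - e"] e(1) by (auto simp: c_def[symmetric])
    then have "f (c - e) < f z" using e(2) zmax[OF e(2)] by (auto simp: Z_def)
    then show False using f_mid[of c e] zmax[OF e(3)] c(2) by simp
  qed
  define x where "x = (1 - t) * a + t * b"
  have xa: "x = a + t * (b - a)" by (simp add: x_def algebra_simps)
  moreover have "0 \<le> t * (b - a)" "t * (b - a) \<le> 1 * (b - a)"
    using t ab by (auto intro!: mult_right_mono)
  ultimately have x: "x \<in> {a..b}" by auto
  have "(x - a) * m = t * (h b - h a)" using ab by (simp add: xa m_def)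
  moreover have "f x \<le> 0" using zmax[OF x] \<open>f z \<le> 0\<close> by simp
  ultimately show "h ((1 - t) *\<^sub>R a + t *\<^sub>R b) \<le> (1 - t) * h a + t * h b"
    by (simp add: f_def x_def algebra_simps)
qed simp

lemma arith_geo_mean_weighted:
  fixes x y c :: real
  assumes "x \<ge> 0" "y \<ge> 0" "c > 0"
  shows "sqrt (x * y) \<le> (c * x + y / c) / 2"
  using arith_geo_mean_sqrt[of "c * x" "y / c"] assms by simp

text \<open>The best weight is the square root of \<open>y / x\<close>, which degenerates if
  \<open>x\<close> or \<open>y\<close> is zero. Both are therefore shifted by \<open>e\<close>, and
  \<open>e\<close> tends to 0.\<close>

lemma le_sqrt_if_le_weighted:
  fixes x y z :: real
  assumes "x \<ge> 0" "y \<ge> 0" and le: "\<And>c. c > 0 \<Longrightarrow> z \<le> (c * x + y / c) / 2"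
  shows "z \<le> sqrt (x * y)"
proof (rule tendsto_lowerbound)
  have "((\<lambda>e. sqrt ((x + e) * (y + e))) \<longlongrightarrow> sqrt ((x + 0) * (y + 0))) (at_right 0)"
    by (intro tendsto_intros)
  then show "((\<lambda>e. sqrt ((x + e) * (y + e))) \<longlongrightarrow> sqrt (x * y)) (at_right 0)" by simp
  show "\<forall>\<^sub>F e in at_right 0. z \<le> sqrt ((x + e) * (y + e))"
  proof (rule eventually_at_right_less[THEN eventually_mono])
    fix e :: real assume e: "0 < e"
    define X Y where "X = sqrt (x + e)" and "Y = sqrt (y + e)"
    have XY: "X > 0" "Y > 0" "X * X = x + e" "Y * Y = y + e"
      using assms e by (auto simp: X_def Y_def)
    have "z \<le> (Y / X * x + y / (Y / X)) / 2" by (rule le) (use XY in simp)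
    also have "\<dots> \<le> (Y / X * (x + e) + (y + e) / (Y / X)) / 2"
      using XY e by (intro divide_right_mono add_mono mult_left_mono) auto
    also have "\<dots> = X * Y" unfolding XY(3,4)[symmetric] using XY(1,2) by (simp add: field_simps)
    finally show "z \<le> sqrt ((x + e) * (y + e))" by (simp add: X_def Y_def real_sqrt_mult)
  qed
qed simp

section \<open>Decreasing enumerations and positive parts\<close>

lemma sum_bij_UNIV: "bij_betw e {..<d :: nat} (UNIV :: 'd set) \<Longrightarrow> (\<Sum>j<d. f (e j)) = (\<Sum>i\<in>UNIV. f i)"
  by (rule sum.reindex_bij_betw)

text \<open>With \<open>sum_positive_part_eq\<close>, this translates thresholded sums, which the
  determinant bounds deliver, into partial sums, which majorization needs.\<close>

lemma sum_le_sum_positive_part: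
  fixes f :: "'d::finite \<Rightarrow> real" and e :: "nat \<Rightarrow> 'd"
  assumes "bij_betw e {..<d} UNIV" "k \<le> d"
  shows "(\<Sum>j<k. f (e j) - \<tau>) \<le> (\<Sum>i\<in>UNIV. max (f i - \<tau>) 0)"
proof -
  have "(\<Sum>j<k. f (e j) - \<tau>) \<le> (\<Sum>j<k. max (f (e j) - \<tau>) 0)" by (rule sum_mono) simp
  also have "\<dots> \<le> (\<Sum>j<d. max (f (e j) - \<tau>) 0)"
    using assms(2) by (intro sum_mono2) auto
  also have "\<dots> = (\<Sum>i\<in>UNIV. max (f i - \<tau>) 0)" by (rule sum_bij_UNIV[OF assms(1)])
  finally show ?thesis .
qed

text \<open>At the threshold \<open>f (e k)\<close> later terms have zero positive part and earlier
  ones are their own positive part. Counting starts at 0, so the threshold is the value in place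
  \<open>Suc k\<close>.\<close>

lemma sum_positive_part_eq:
  fixes f :: "'d::finite \<Rightarrow> real" and e :: "nat \<Rightarrow> 'd"
  assumes e: "bij_betw e {..<d} UNIV" and anti: "\<And>i j. i \<le> j \<Longrightarrow> j < d \<Longrightarrow> f (e j) \<le> f (e i)"
    and k: "k < d"
  shows "(\<Sum>i\<in>UNIV. max (f i - f (e k)) 0) = (\<Sum>j<Suc k. f (e j) - f (e k))"
proof -
  have "(\<Sum>i\<in>UNIV. max (f i - f (e k)) 0) = (\<Sum>j<d. max (f (e j) - f (e k)) 0)"
    by (rule sum_bij_UNIV[OF e, symmetric])
  also have "\<dots> = (\<Sum>j<Suc k. max (f (e j) - f (e k)) 0)"
  proof (rule sum.mono_neutral_right)
    show "\<forall>i\<in>{..<d} - {..<Suc k}. max (f (e i) - f (e k)) 0 = 0"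
    proof
      fix i assume "i \<in> {..<d} - {..<Suc k}"
      then have "f (e i) \<le> f (e k)" by (intro anti) auto
      then show "max (f (e i) - f (e k)) 0 = 0" by simp
    qed
  qed (use k in auto)
  also have "\<dots> = (\<Sum>j<Suc k. f (e j) - f (e k))"
  proof (rule sum.cong)
    fix j assume "j \<in> {..<Suc k}"
    then have "f (e k) \<le> f (e j)" using k by (intro anti) auto
    then show "max (f (e j) - f (e k)) 0 = f (e j) - f (e k)" by simp
  qed simp
  finally show ?thesis .
qed

lemma exists_antimono_enumeration:
  fixes f :: "'d::finite \<Rightarrow> real"
  shows "\<exists>e :: nat \<Rightarrow> 'd. bij_betw e {..<CARD('d)} UNIV \<and> (\<forall>i j. i \<le> j \<longrightarrow> j < CARD('d) \<longrightarrow> f (e j) \<le> f (e i))"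
proof -
  obtain xs :: "'d list" where xs: "set xs = UNIV" "distinct xs"
    using finite_distinct_list[OF finite[of UNIV]] by blast
  define ys where "ys = sort_key (\<lambda>x. - f x) xs"
  have ys: "set ys = UNIV" "distinct ys" "length ys = CARD('d)"
    using xs distinct_card[of xs] by (auto simp: ys_def)
  have "sorted (map (\<lambda>x. - f x) ys)" by (simp add: ys_def)
  then have "f (ys ! j) \<le> f (ys ! i)" if "i \<le> j" "j < CARD('d)" for i j
    using that ys(3) by (auto simp: sorted_iff_nth_mono)
  moreover have "bij_betw ((!) ys) {..<CARD('d)} UNIV"
    using bij_betw_nth[OF ys(2) refl, of UNIV] ys by simp
  ultimately show ?thesis by blast
qed

text \<open>The enumeration \<open>e\<close> stays fixed and the function is rearranged instead.
  Several functions can thus be sorted along one \<open>e\<close>, by permutations that leave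
  \<open>diag_norm\<close> invariant.\<close>

lemma exists_antimono_permutation:
  fixes f :: "'d::finite \<Rightarrow> real" and e :: "nat \<Rightarrow> 'd"
  assumes e: "bij_betw e {..<CARD('d)} UNIV"
  shows "\<exists>\<pi> :: 'd \<Rightarrow> 'd. bij \<pi> \<and>
           (\<forall>i j. i \<le> j \<longrightarrow> j < CARD('d) \<longrightarrow> f (\<pi> (e j)) \<le> f (\<pi> (e i)))"
proof -
  obtain e' where e': "bij_betw e' {..<CARD('d)} (UNIV :: 'd set)"
    "\<And>i j. i \<le> j \<Longrightarrow> j < CARD('d) \<Longrightarrow> f (e' j) \<le> f (e' i)"
    using exists_antimono_enumeration[of f] by blast
  define \<pi> where "\<pi> = e' \<circ> inv_into {..<CARD('d)} e"
  have "\<pi> (e j) = e' j" if "j < CARD('d)" for j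
    using that e by (simp add: \<pi>_def bij_betw_def inv_into_f_f)
  moreover have "bij \<pi>"
    unfolding \<pi>_def by (rule bij_betw_trans[OF bij_betw_inv_into[OF e] e'(1)])
  ultimately show ?thesis using e'(2) by (intro exI[of _ \<pi>]) auto
qed

section \<open>Symmetric norms on real diagonal matrices\<close>

text \<open>For a symmetric norm \<open>N\<close> this is the symmetric gauge function of von
  Neumann: a norm on real vectors, invariant under permutations and sign changes.\<close>

definition diag_norm :: "(complex^'d^'d \<Rightarrow> real) \<Rightarrow> real^'d \<Rightarrow> real" where
  "diag_norm N x = N (diag_mat (\<lambda>i. of_real (x $ i)))"

context
  fixes N :: "complex^'d::finite^'d \<Rightarrow> real"
  assumes N: "symmetric_norm N"
begin

lemma diag_norm_nonneg: "0 \<le> diag_norm N x"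
  using N by (simp add: diag_norm_def symmetric_norm_def)

lemma diag_norm_triangle: "diag_norm N (x + y) \<le> diag_norm N x + diag_norm N y"
proof -
  have "diag_mat (\<lambda>i. complex_of_real ((x + y) $ i))
      = diag_mat (\<lambda>i. of_real (x $ i)) + diag_mat (\<lambda>i. of_real (y $ i))"
    by (simp add: diag_mat_def vec_eq_iff)
  then show ?thesis using N unfolding diag_norm_def symmetric_norm_def by metis
qed

lemma diag_norm_scale: "diag_norm N (c *\<^sub>R x) = \<bar>c\<bar> * diag_norm N x"
proof -
  have "diag_mat (\<lambda>i. complex_of_real ((c *\<^sub>R x) $ i))
      = mat_scale (of_real c) (diag_mat (\<lambda>i. of_real (x $ i)))"
    by (simp add: diag_mat_def vec_eq_iff mat_scale_def)
  then show ?thesis using N unfolding diag_norm_def symmetric_norm_def by (metis norm_of_real)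
qed

lemma diag_norm_sign:
  assumes "\<And>i. \<bar>s i\<bar> = 1"
  shows "diag_norm N (\<chi> i. s i * x $ i) = diag_norm N x"
proof -
  define U :: "complex^'d^'d" where "U = diag_mat (\<lambda>i. of_real (s i))"
  have "s i * s i = 1" for i
    using assms[of i] by (metis abs_mult_self_eq mult_1)
  then have "U ** U = mat 1"
    by (simp add: U_def diag_mat_mul flip: of_real_mult diag_mat_one)
  then have "unitary_mat U" by (simp add: unitary_mat_def U_def mat_adj_diag_real)
  moreover have "diag_mat (\<lambda>i. complex_of_real ((\<chi> i. s i * x $ i) $ i))
      = U ** diag_mat (\<lambda>i. of_real (x $ i)) ** mat 1"
    by (simp add: U_def diag_mat_mul)
  ultimately show ?thesis
    using N unitary_mat_1 unfolding diag_norm_def symmetric_norm_def by metis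
qed

lemma diag_norm_permute:
  assumes "bij \<pi>"
  shows "diag_norm N (\<chi> i. x $ \<pi> i) = diag_norm N x"
proof -
  define U :: "complex^'d^'d" where "U = (\<chi> i j. if j = \<pi> i then 1 else 0)"
  have inj: "\<pi> i = \<pi> j \<longleftrightarrow> i = j" for i j using assms by (meson bij_def inj_eq)
  have *: "(U ** M ** mat_adj U) $ i $ j = M $ \<pi> i $ \<pi> j" for M i j
  proof -
    have "(\<Sum>l\<in>UNIV. (if l = \<pi> i then 1 else 0) * M $ l $ k) = M $ \<pi> i $ k" for k
    proof -
      have "(\<Sum>l\<in>UNIV. (if l = \<pi> i then 1 else 0) * M $ l $ k) = (\<Sum>l\<in>UNIV. if l = \<pi> i then M $ l $ k else 0)"
        by (rule sum.cong) auto
      then show ?thesis by simp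
    qed
    then have "(U ** M ** mat_adj U) $ i $ j = (\<Sum>k\<in>UNIV. M $ \<pi> i $ k * cnj (if k = \<pi> j then 1 else 0))"
      by (simp add: matrix_matrix_mult_def U_def mat_adj_def)
    also have "\<dots> = (\<Sum>k\<in>UNIV. if k = \<pi> j then M $ \<pi> i $ k else 0)"
      by (rule sum.cong) auto
    finally show ?thesis by simp
  qed
  have "(U ** mat 1 ** mat_adj U) $ i $ j = mat 1 $ i $ j" for i j
    unfolding * by (simp add: mat_def inj)
  then have "U ** mat_adj U = mat 1" by (simp add: vec_eq_iff)
  then have "unitary_mat U" by (simp add: unitary_mat_def matrix_left_right_inverse)
  moreover have "diag_mat (\<lambda>i. complex_of_real ((\<chi> i. x $ \<pi> i) $ i))
      = U ** diag_mat (\<lambda>i. of_real (x $ i)) ** mat_adj U"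
    by (simp add: vec_eq_iff *) (simp add: diag_mat_def inj)
  ultimately show ?thesis
    using N unitary_mat_adj unfolding diag_norm_def symmetric_norm_def by metis
qed

lemma diag_norm_udiag:
  assumes "unitary_mat U"
  shows "N (udiag U l) = diag_norm N (\<chi> i. l i)"
  using N unitary_mat_adj[OF assms] assms
  unfolding diag_norm_def symmetric_norm_def udiag_def by simp

lemma convex_on_diag_norm: "convex_on UNIV (diag_norm N)"
proof (rule convex_onI)
  fix t :: real and x y :: "real^'d"
  assume "0 < t" "t < 1"
  then show "diag_norm N ((1 - t) *\<^sub>R x + t *\<^sub>R y) \<le> (1 - t) * diag_norm N x + t * diag_norm N y"
    using diag_norm_triangle[of "(1 - t) *\<^sub>R x" "t *\<^sub>R y"] by (simp add: diag_norm_scale)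
qed simp

lemma continuous_on_diag_norm: "continuous_on UNIV (diag_norm N)"
  by (rule convex_on_continuous[OF open_UNIV convex_on_diag_norm])

text \<open>The sublevel set of \<open>y\<close> is closed, convex and invariant under signed permutations; a
  hyperplane separating \<open>x\<close> from it would contradict the rearrangement inequality.\<close>

lemma diag_norm_weak_majorization:
  fixes x y :: "real^'d" and e :: "nat \<Rightarrow> 'd"
  assumes e: "bij_betw e {..<CARD('d)} (UNIV :: 'd set)"
    and x0: "\<And>i. 0 \<le> x $ i"
    and xs: "\<And>i j. i \<le> j \<Longrightarrow> j < CARD('d) \<Longrightarrow> x $ e j \<le> x $ e i"
    and le: "\<And>k. k \<le> CARD('d) \<Longrightarrow> (\<Sum>j<k. x $ e j) \<le> (\<Sum>j<k. y $ e j)"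
  shows "diag_norm N x \<le> diag_norm N y"
proof (rule ccontr)
  define d where "d = CARD('d)"
  note e = e[folded d_def] and xs = xs[folded d_def] and le = le[folded d_def]
  define S where "S = {z. diag_norm N z \<le> diag_norm N y}"
  assume "\<not> diag_norm N x \<le> diag_norm N y"
  then have xS: "x \<notin> S" by (simp add: S_def)
  have convS: "convex S"
  proof (rule convexI)
    fix p q and u v :: real
    assume *: "p \<in> S" "q \<in> S" "0 \<le> u" "0 \<le> v" "u + v = 1"
    have "diag_norm N (u *\<^sub>R p + v *\<^sub>R q) \<le> u * diag_norm N p + v * diag_norm N q"
      using diag_norm_triangle[of "u *\<^sub>R p" "v *\<^sub>R q"] * by (simp add: diag_norm_scale)
    also have "\<dots> \<le> u * diag_norm N y + v * diag_norm N y"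
      using * by (intro add_mono mult_left_mono) (auto simp: S_def)
    also have "\<dots> = diag_norm N y" using * by (simp flip: distrib_right)
    finally show "u *\<^sub>R p + v *\<^sub>R q \<in> S" by (simp add: S_def)
  qed
  have closS: "closed S"
    unfolding S_def by (intro closed_Collect_le continuous_on_diag_norm continuous_on_const)
  from separating_hyperplane_closed_point[OF convS closS xS]
  obtain a b where ab: "a \<bullet> x < b" "\<And>z. z \<in> S \<Longrightarrow> b < a \<bullet> z" by blast
  define w where "w i = \<bar>a $ i\<bar>" for i
  obtain \<pi> where \<pi>: "bij \<pi>" and "\<forall>i j. i \<le> j \<longrightarrow> j < d \<longrightarrow> w (\<pi> (e j)) \<le> w (\<pi> (e i))"
    using exists_antimono_permutation[OF e[unfolded d_def], of w] unfolding d_def by blast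
  then have ws: "w (\<pi> (e j)) \<le> w (\<pi> (e i))" if "i \<le> j" "j < d" for i j
    using that by blast
  define s :: "'d \<Rightarrow> real" where "s i = (if a $ i > 0 then -1 else 1)" for i
  \<comment> \<open>A signed permutation of \<open>y\<close>, hence in \<open>S\<close>. The signs
    oppose those of \<open>a\<close>, and the permutation pairs the largest \<open>w\<close> with
    the first entries of \<open>y\<close> along \<open>e\<close>.\<close>
  define z where "z = (\<chi> i. s i * (\<chi> i. y $ inv \<pi> i) $ i)"
  have "diag_norm N z = diag_norm N (\<chi> i. y $ inv \<pi> i)"
    unfolding z_def by (rule diag_norm_sign) (simp add: s_def)
  also have "\<dots> = diag_norm N y"
    by (rule diag_norm_permute) (rule bij_imp_bij_inv[OF \<pi>])
  finally have "z \<in> S" by (simp add: S_def)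
  have "a \<bullet> z = (\<Sum>i\<in>UNIV. - w i * y $ inv \<pi> i)"
    by (auto simp: inner_vec_def z_def s_def w_def intro!: sum.cong)
  also have "\<dots> = (\<Sum>i\<in>UNIV. - w (\<pi> i) * y $ inv \<pi> (\<pi> i))"
    by (rule sum.reindex_bij_betw[OF \<pi>, symmetric])
  also have "\<dots> = - (\<Sum>i\<in>UNIV. w (\<pi> i) * y $ i)"
    using \<pi> by (simp add: sum_negf bij_is_inj)
  finally have az: "a \<bullet> z = - (\<Sum>j<d. w (\<pi> (e j)) * y $ e j)"
    by (simp add: sum_bij_UNIV[OF e, of "\<lambda>i. w (\<pi> i) * y $ i"])
  \<comment> \<open>Rearrangement inequality by Abel summation: the \<open>k\<close> largest values
    of \<open>w\<close> have at least the sum of its values at the first \<open>k\<close> indices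
    along \<open>e\<close>.\<close>
  have "0 \<le> (\<Sum>j<d. x $ e j * (w (\<pi> (e j)) - w (e j)))"
  proof (rule sum_mult_antimono_nonneg)
    fix k assume k: "k \<le> d"
    show "0 \<le> (\<Sum>j<k. w (\<pi> (e j)) - w (e j))"
    proof (cases k)
      case (Suc n)
      have "bij_betw (\<pi> \<circ> e) {..<d} UNIV" by (rule bij_betw_trans[OF e \<pi>])
      from sum_positive_part_eq[OF this, of w n] sum_le_sum_positive_part[OF e k, of w "w (\<pi> (e n))"]
      have "(\<Sum>j<k. w (e j) - w (\<pi> (e n))) \<le> (\<Sum>j<k. w (\<pi> (e j)) - w (\<pi> (e n)))"
        using ws k Suc by simp
      then show ?thesis by (simp add: sum_subtractf)
    qed simp
  qed (use x0 xs in auto)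
  \<comment> \<open>The chain from here returns to its initial sum, with one strict inequality
    coming from the hyperplane.\<close>
  then have "(\<Sum>j<d. w (e j) * x $ e j) \<le> (\<Sum>j<d. w (\<pi> (e j)) * x $ e j)"
    by (simp add: algebra_simps sum_subtractf)
  also have "\<dots> \<le> (\<Sum>j<d. w (\<pi> (e j)) * y $ e j)"
  proof -
    have "0 \<le> (\<Sum>j<d. w (\<pi> (e j)) * (y $ e j - x $ e j))"
      by (rule sum_mult_antimono_nonneg) (use ws le in \<open>auto simp: sum_subtractf w_def\<close>)
    then show ?thesis by (simp add: algebra_simps sum_subtractf)
  qed
  also have "\<dots> < (\<Sum>i\<in>UNIV. - a $ i * x $ i)"
    using ab(1) ab(2)[OF \<open>z \<in> S\<close>] az by (simp add: inner_vec_def sum_negf)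
  also have "\<dots> \<le> (\<Sum>i\<in>UNIV. w i * x $ i)"
    using x0 by (intro sum_mono mult_right_mono) (auto simp: w_def)
  also have "\<dots> = (\<Sum>j<d. w (e j) * x $ e j)"
    by (simp add: sum_bij_UNIV[OF e, of "\<lambda>i. w i * x $ i"])
  finally show False by simp
qed

end

section \<open>Log-convexity\<close>

lemma ln_prod_max_one:
  fixes x :: "'d::finite \<Rightarrow> real" and s :: real
  assumes "\<And>i. x i > 0" "s > 0"
  shows "ln (\<Prod>i\<in>UNIV. max (x i / s) 1) = (\<Sum>i\<in>UNIV. max (ln (x i) - ln s) 0)"
proof -
  have "ln (max (x i / s) 1) = max (ln (x i) - ln s) 0" for i
  proof -
    have "0 < x i / s" using assms by simp
    then have "ln (max (x i / s) 1) = max (ln (x i / s)) 0" by (auto simp: max_def)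
    also have "ln (x i / s) = ln (x i) - ln s" using assms(1)[of i] assms(2) by (simp add: ln_div)
    finally show ?thesis .
  qed
  moreover have "max (x i / s) 1 \<noteq> 0" for i by (smt (verit) max.cobounded2)
  ultimately show ?thesis by (simp add: ln_prod)
qed

text \<open>The logarithm of \<open>prod_max_psd_block_le\<close> at the thresholds
  \<open>exp \<alpha>\<close> and \<open>exp \<beta>\<close>, whose geometric mean has logarithm
  \<open>(\<alpha> + \<beta>) / 2\<close>.\<close>

lemma sum_max_ln_psd_block_le:
  fixes U V W :: "complex^'d::finite^'d"
  assumes "unitary_mat U" "unitary_mat V" "unitary_mat W"
    and "psd_block (udiag V p) (udiag U r) (udiag W q)"
    and pos: "\<And>i. p i > 0" "\<And>i. q i > 0" "\<And>i. r i > 0"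
  shows "2 * (\<Sum>i\<in>UNIV. max (ln (r i) - (\<alpha> + \<beta>) / 2) 0)
    \<le> (\<Sum>i\<in>UNIV. max (ln (p i) - \<alpha>) 0) + (\<Sum>i\<in>UNIV. max (ln (q i) - \<beta>) 0)"
proof -
  define a b where "a = exp \<alpha>" and "b = exp \<beta>"
  have ab: "a > 0" "b > 0" "sqrt (a * b) > 0" by (simp_all add: a_def b_def)
  have lns: "ln a = \<alpha>" "ln b = \<beta>" "ln (sqrt (a * b)) = (\<alpha> + \<beta>) / 2"
    by (simp_all add: a_def b_def ln_sqrt ln_mult)
  define R P Q where "R = (\<Prod>i\<in>UNIV. max (r i / sqrt (a * b)) 1)"
    and "P = (\<Prod>i\<in>UNIV. max (p i / a) 1)" and "Q = (\<Prod>i\<in>UNIV. max (q i / b) 1)"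
  have RPQ: "R > 0" "P > 0" "Q > 0"
    by (auto simp: R_def P_def Q_def intro!: prod_pos)
  have "R\<^sup>2 \<le> P * Q"
    unfolding R_def P_def Q_def by (rule prod_max_psd_block_le[OF assms(1-4) ab(1,2)])
  then have "ln (R\<^sup>2) \<le> ln (P * Q)" using RPQ by simp
  moreover have "ln (R\<^sup>2) = 2 * ln R" using RPQ by (simp add: ln_realpow)
  moreover have "ln (P * Q) = ln P + ln Q" using RPQ by (simp add: ln_mult)
  ultimately have "2 * ln R \<le> ln P + ln Q" by linarith
  then show ?thesis
    unfolding R_def P_def Q_def ln_prod_max_one[OF pos(1) ab(1)] ln_prod_max_one[OF pos(2) ab(2)]
      ln_prod_max_one[OF pos(3) ab(3)] lns .
qed

section \<open>Geometrically convex functions of eigenvalues\<close>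

lemma continuous_on_exp_comp:
  "geom_convex g \<Longrightarrow> continuous_on UNIV (\<lambda>t. g (exp t))"
  by (rule continuous_on_compose2[of "{0..}" g]) (auto simp: geom_convex_def intro: continuous_intros)

lemma geom_convex_exp_midpoint:
  assumes "geom_convex g"
  shows "g (exp ((x + y) / 2)) \<le> sqrt (g (exp x) * g (exp y))"
proof -
  have "sqrt (exp x * exp y) = exp ((x + y) / 2)"
    by (rule real_sqrt_unique) (simp_all add: power2_eq_square flip: exp_add)
  then show ?thesis
    using assms unfolding geom_convex_def by (metis exp_gt_zero)
qed

lemma geom_convex_nonneg: "geom_convex g \<Longrightarrow> 0 \<le> x \<Longrightarrow> 0 \<le> g x"
  by (simp add: geom_convex_def)

text \<open>Geometric convexity of \<open>g\<close> is midpoint log-convexity of \<open>g\<close>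
  after \<open>exp\<close>. The arithmetic-geometric mean inequality weakens it to midpoint
  convexity.\<close>

lemma convex_on_exp_comp:
  assumes "geom_convex g"
  shows "convex_on UNIV (\<lambda>t. g (exp t))"
proof (rule convex_on_midpoint_continuous[OF continuous_on_exp_comp[OF assms]])
  fix x y
  have "sqrt (g (exp x) * g (exp y)) \<le> (g (exp x) + g (exp y)) / 2"
    by (intro arith_geo_mean_sqrt geom_convex_nonneg[OF assms]) auto
  then show "g (exp ((x + y) / 2)) \<le> (g (exp x) + g (exp y)) / 2"
    using geom_convex_exp_midpoint[OF assms, of x y] by linarith
qed

lemma diag_norm_psd_block_le_pos:
  fixes U V W :: "complex^'d::finite^'d"
  assumes N: "symmetric_norm N" and g: "mono_on {0..} g" "geom_convex g"
    and "unitary_mat U" "unitary_mat V" "unitary_mat W"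
    and "psd_block (udiag V p) (udiag U r) (udiag W q)"
    and pos: "\<And>i. p i > 0" "\<And>i. q i > 0" "\<And>i. r i > 0"
  shows "diag_norm N (\<chi> i. g (r i)) \<le> sqrt (diag_norm N (\<chi> i. g (p i)) * diag_norm N (\<chi> i. g (q i)))"
proof (rule le_sqrt_if_le_weighted)
  fix c :: real assume c: "c > 0"
  define d where "d = CARD('d)"
  note pos0 = less_imp_le[OF pos(1)] less_imp_le[OF pos(2)] less_imp_le[OF pos(3)]
  obtain e :: "nat \<Rightarrow> 'd" where e: "bij_betw e {..<d} UNIV"
    using exists_antimono_enumeration[of "\<lambda>_. 0"] unfolding d_def by blast
  have "\<exists>\<pi>. bij \<pi> \<and> (\<forall>i j. i \<le> j \<longrightarrow> j < d \<longrightarrow> ln (f (\<pi> (e j))) \<le> ln (f (\<pi> (e i))))" for f :: "'d \<Rightarrow> real"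
    unfolding d_def by (rule exists_antimono_permutation[OF e[unfolded d_def]])
  \<comment> \<open>\<open>\<sigma> f\<close> is a permutation that sorts \<open>f\<close> in
    decreasing order along \<open>e\<close>, one for each function.\<close>
  then obtain \<sigma> where bij: "\<And>f :: 'd \<Rightarrow> real. bij (\<sigma> f)"
    and anti: "\<And>(f :: 'd \<Rightarrow> real) i j. i \<le> j \<Longrightarrow> j < d \<Longrightarrow> ln (f (\<sigma> f (e j))) \<le> ln (f (\<sigma> f (e i)))"
    by metis
  have bij': "bij_betw (\<lambda>j. \<sigma> f (e j)) {..<d} UNIV" for f
    using bij_betw_trans[OF e bij[of f]] by (simp add: o_def)
  define lp lq lr where "lp j = ln (p (\<sigma> p (e j)))" and "lq j = ln (q (\<sigma> q (e j)))"
    and "lr j = ln (r (\<sigma> r (e j)))" for j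
  \<comment> \<open>The thresholds are the smallest among the first \<open>k\<close> sorted
    logarithms of \<open>p\<close> and of \<open>q\<close>. There the positive parts on the right
    are exactly partial sums.\<close>
  have major: "(\<Sum>j<k. lr j) \<le> (\<Sum>j<k. (lp j + lq j) / 2)" if "k \<le> d" for k
  proof (cases k)
    case (Suc n)
    then have n: "n < d" using that by simp
    have "2 * (\<Sum>j<k. lr j - (lp n + lq n) / 2) \<le> 2 * (\<Sum>i\<in>UNIV. max (ln (r i) - (lp n + lq n) / 2) 0)"
      unfolding lr_def by (intro mult_left_mono sum_le_sum_positive_part[OF bij' that]) simp
    also have "\<dots> \<le> (\<Sum>i\<in>UNIV. max (ln (p i) - lp n) 0) + (\<Sum>i\<in>UNIV. max (ln (q i) - lq n) 0)"
      by (rule sum_max_ln_psd_block_le[OF assms(4-7) pos])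
    also have "\<dots> = (\<Sum>j<k. lp j - lp n) + (\<Sum>j<k. lq j - lq n)"
      using sum_positive_part_eq[OF bij' anti n, of p] sum_positive_part_eq[OF bij' anti n, of q]
      unfolding lp_def lq_def Suc by simp
    finally show ?thesis
      by (simp add: sum_subtractf sum.distrib sum_divide_distrib[symmetric] algebra_simps add_divide_distrib)
  qed simp
  define x where "x = (\<chi> i. g (r (\<sigma> r i)))"
  \<comment> \<open>An arithmetic mean with weight \<open>c\<close> of the values at
    \<open>p\<close> and \<open>q\<close>, each sorted. Being linear in them, it is open to the
    triangle inequality.\<close>
  define y where "y = (\<chi> i. (c * g (p (\<sigma> p i)) + g (q (\<sigma> q i)) / c) / 2)"
  have g_exp: "g (exp (ln t)) = g t" if "t > 0" for t using that by simp
  have "diag_norm N x \<le> diag_norm N y"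
  proof (rule diag_norm_weak_majorization[OF N e[unfolded d_def]], fold d_def)
    show "0 \<le> x $ i" for i
      using pos0 by (simp add: x_def geom_convex_nonneg[OF g(2)])
    show "x $ e j \<le> x $ e i" if "i \<le> j" "j < d" for i j
    proof -
      have "r (\<sigma> r (e j)) \<le> r (\<sigma> r (e i))" using anti[OF that, of r] pos(3) by simp
      then show ?thesis using pos0(3) by (simp add: x_def mono_onD[OF g(1)])
    qed
    show "(\<Sum>j<k. x $ e j) \<le> (\<Sum>j<k. y $ e j)" if k: "k \<le> d" for k
    proof -
      have "(\<Sum>j<k. x $ e j) = (\<Sum>j<k. g (exp (lr j)))"
        using pos(3) by (simp add: x_def lr_def)
      also have "\<dots> \<le> (\<Sum>j<k. g (exp ((lp j + lq j) / 2)))"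
      proof (rule sum_mono_of_weak_majorization[OF convex_on_exp_comp[OF g(2)]])
        show "mono (\<lambda>t. g (exp t))"
          by (intro monoI mono_onD[OF g(1)]) auto
        show "lr j \<le> lr i" if "i \<le> j" "j < k" for i j
          unfolding lr_def using that k by (intro anti) auto
        show "(\<Sum>j<l. lr j) \<le> (\<Sum>j<l. (lp j + lq j) / 2)" if "l \<le> k" for l
          by (rule major) (use that k in simp)
      qed
      also have "\<dots> \<le> (\<Sum>j<k. y $ e j)"
      proof (rule sum_mono)
        fix j
        have "g (exp ((lp j + lq j) / 2)) \<le> sqrt (g (exp (lp j)) * g (exp (lq j)))"
          by (rule geom_convex_exp_midpoint[OF g(2)])
        also have "\<dots> \<le> (c * g (exp (lp j)) + g (exp (lq j)) / c) / 2"
          by (intro arith_geo_mean_weighted geom_convex_nonneg[OF g(2)] c) auto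
        also have "\<dots> = y $ e j" using pos by (simp add: y_def lp_def lq_def)
        finally show "g (exp ((lp j + lq j) / 2)) \<le> y $ e j" .
      qed
      finally show ?thesis .
    qed
  qed
  also have "diag_norm N x = diag_norm N (\<chi> i. g (r i))"
    using diag_norm_permute[OF N bij[of r], of "\<chi> i. g (r i)"] by (simp add: x_def)
  also have "diag_norm N y \<le> c / 2 * diag_norm N (\<chi> i. g (p i)) + 1 / (2 * c) * diag_norm N (\<chi> i. g (q i))"
  proof -
    define yp yq where "yp = (\<chi> i. g (p (\<sigma> p i)))" and "yq = (\<chi> i. g (q (\<sigma> q i)))"
    have "y = (c / 2) *\<^sub>R yp + (1 / (2 * c)) *\<^sub>R yq"
      using c by (simp add: vec_eq_iff y_def yp_def yq_def field_simps)
    then have "diag_norm N y \<le> c / 2 * diag_norm N yp + 1 / (2 * c) * diag_norm N yq"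
      using diag_norm_triangle[OF N, of "(c / 2) *\<^sub>R yp" "(1 / (2 * c)) *\<^sub>R yq"] c
      by (simp add: diag_norm_scale[OF N])
    moreover have "diag_norm N yp = diag_norm N (\<chi> i. g (p i))"
      using diag_norm_permute[OF N bij[of p], of "\<chi> i. g (p i)"] by (simp add: yp_def)
    moreover have "diag_norm N yq = diag_norm N (\<chi> i. g (q i))"
      using diag_norm_permute[OF N bij[of q], of "\<chi> i. g (q i)"] by (simp add: yq_def)
    ultimately show ?thesis by simp
  qed
  also have "c / 2 * diag_norm N (\<chi> i. g (p i)) + 1 / (2 * c) * diag_norm N (\<chi> i. g (q i))
    = (c * diag_norm N (\<chi> i. g (p i)) + diag_norm N (\<chi> i. g (q i)) / c) / 2"
    using c by (simp add: field_simps)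
  finally show "diag_norm N (\<chi> i. g (r i)) \<le> (c * diag_norm N (\<chi> i. g (p i)) + diag_norm N (\<chi> i. g (q i)) / c) / 2" .
qed (rule diag_norm_nonneg[OF N])+

text \<open>Logarithms need positive eigenvalues. Adding the block with three copies of
  \<open>\<epsilon> *\<^sub>R mat 1\<close> shifts all eigenvalues by \<open>\<epsilon>\<close>, and
  continuity of \<open>g\<close> and of \<open>diag_norm\<close> allows the limit.\<close>

lemma diag_norm_psd_block_le:
  fixes U V W :: "complex^'d::finite^'d"
  assumes N: "symmetric_norm N" and g: "mono_on {0..} g" "geom_convex g"
    and U: "unitary_mat U" and V: "unitary_mat V" and W: "unitary_mat W"
    and psd_block: "psd_block (udiag V p) (udiag U r) (udiag W q)"
    and nonneg: "\<And>i. p i \<ge> 0" "\<And>i. q i \<ge> 0" "\<And>i. r i \<ge> 0"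
  shows "diag_norm N (\<chi> i. g (r i)) \<le> sqrt (diag_norm N (\<chi> i. g (p i)) * diag_norm N (\<chi> i. g (q i)))"
proof -
  have lim: "((\<lambda>\<epsilon>. diag_norm N (\<chi> i. g (l i + \<epsilon>))) \<longlongrightarrow> diag_norm N (\<chi> i. g (l i))) (at_right 0)"
    if l: "\<And>i. l i \<ge> 0" for l :: "'d \<Rightarrow> real"
  proof (rule continuous_on_tendsto_compose[OF continuous_on_diag_norm[OF N]])
    show "((\<lambda>\<epsilon>. \<chi> i. g (l i + \<epsilon>)) \<longlongrightarrow> (\<chi> i. g (l i))) (at_right 0)"
    proof (rule tendsto_vec_lambda)
      fix i
      have "((\<lambda>\<epsilon>. l i + \<epsilon>) \<longlongrightarrow> l i + 0) (at_right 0)" by (intro tendsto_intros)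
      \<comment> \<open>Continuity of \<open>g\<close> is known only on \<open>{0..}\<close>, so the
        arguments must stay there.\<close>
      moreover have "\<forall>\<^sub>F \<epsilon> in at_right 0. l i + \<epsilon> \<in> {0..}"
        by (rule eventually_at_right_less[THEN eventually_mono]) (use l[of i] in auto)
      ultimately show "((\<lambda>\<epsilon>. g (l i + \<epsilon>)) \<longlongrightarrow> g (l i)) (at_right 0)"
        using g(2) l[of i] by (intro continuous_on_tendsto_compose[of "{0..}" g]) (auto simp: geom_convex_def)
    qed
  qed auto
  show ?thesis
  proof (rule tendsto_le[OF _ _ lim[OF nonneg(3)]])
    show "((\<lambda>\<epsilon>. sqrt (diag_norm N (\<chi> i. g (p i + \<epsilon>)) * diag_norm N (\<chi> i. g (q i + \<epsilon>)))) \<longlongrightarrow>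
      sqrt (diag_norm N (\<chi> i. g (p i)) * diag_norm N (\<chi> i. g (q i)))) (at_right 0)"
      by (intro tendsto_intros lim nonneg)
    show "\<forall>\<^sub>F \<epsilon> in at_right 0. diag_norm N (\<chi> i. g (r i + \<epsilon>))
      \<le> sqrt (diag_norm N (\<chi> i. g (p i + \<epsilon>)) * diag_norm N (\<chi> i. g (q i + \<epsilon>)))"
    proof (rule eventually_at_right_less[THEN eventually_mono])
      fix \<epsilon> :: real assume \<epsilon>: "0 < \<epsilon>"
      have "psd_block ((sqrt \<epsilon> * sqrt \<epsilon>) *\<^sub>R (mat 1 :: complex^'d^'d)) ((sqrt \<epsilon> * sqrt \<epsilon>) *\<^sub>R mat 1) ((sqrt \<epsilon> * sqrt \<epsilon>) *\<^sub>R mat 1)"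
        by (rule psd_block_scaled_copies) (simp_all add: hermitian_def cip_self_Re)
      moreover have "udiag Z l + \<epsilon> *\<^sub>R mat 1 = udiag Z (\<lambda>i. l i + \<epsilon>)" if "unitary_mat Z" for Z :: "complex^'d^'d" and l
        using udiag_scale[of \<epsilon> Z "\<lambda>_. 1"] by (simp add: udiag_one[OF that] udiag_add)
      ultimately have "psd_block (udiag V (\<lambda>i. p i + \<epsilon>)) (udiag U (\<lambda>i. r i + \<epsilon>)) (udiag W (\<lambda>i. q i + \<epsilon>))"
        using psd_block_add[OF psd_block] U V W \<epsilon> by fastforce
      then show "diag_norm N (\<chi> i. g (r i + \<epsilon>))
        \<le> sqrt (diag_norm N (\<chi> i. g (p i + \<epsilon>)) * diag_norm N (\<chi> i. g (q i + \<epsilon>)))"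
        by (rule diag_norm_psd_block_le_pos[OF N g U V W]) (use nonneg \<epsilon> add_nonneg_pos in blast)+
    qed
  qed simp
qed

lemma psd_Re: "psd A \<Longrightarrow> 0 \<le> Re (cip x (A *v x))"
  by (simp add: psd_def qform_cip)

lemma psd_udiag:
  fixes A :: "complex^'d::finite^'d"
  assumes "psd A"
  obtains U l where "unitary_mat U" "A = udiag U l" "\<forall>i. 0 \<le> l i"
proof -
  obtain U l where U: "unitary_mat U" "A = udiag U l"
    using psd_hermitian[OF assms] by (rule spectral_hermitian)
  have "0 \<le> l i" for i
    using psd_Re[OF assms, of "U *v axis i 1"] by (simp add: U(2) udiag_eigenvector(1)[OF U(1)])
  with U show ?thesis using that by blast
qed

lemma norm_mat_fun_psd_block_le:
  fixes P Q R :: "complex^'d::finite^'d"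
  assumes N: "symmetric_norm N" and g: "mono_on {0..} g" "geom_convex g"
    and psd: "psd P" "psd Q" "psd R" and psd_block: "psd_block P R Q"
  shows "N (mat_fun g R) \<le> sqrt (N (mat_fun g P) * N (mat_fun g Q))"
proof -
  obtain U r where U: "unitary_mat U" "R = udiag U r" "\<forall>i. 0 \<le> r i" using psd(3) by (rule psd_udiag)
  obtain V p where V: "unitary_mat V" "P = udiag V p" "\<forall>i. 0 \<le> p i" using psd(1) by (rule psd_udiag)
  obtain W q where W: "unitary_mat W" "Q = udiag W q" "\<forall>i. 0 \<le> q i" using psd(2) by (rule psd_udiag)
  have "diag_norm N (\<chi> i. g (r i)) \<le> sqrt (diag_norm N (\<chi> i. g (p i)) * diag_norm N (\<chi> i. g (q i)))"
    using psd_block unfolding U(2) V(2) W(2)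
    by (rule diag_norm_psd_block_le[OF N g U(1) V(1) W(1)]) (use U(3) V(3) W(3) in blast)+
  then show ?thesis
    by (simp add: U(1,2) V(1,2) W(1,2) mat_fun_udiag diag_norm_udiag[OF N])
qed

section \<open>Geodesics as sums of rank one matrices\<close>

definition rank1 :: "complex^'n \<Rightarrow> complex^'n^'n" where
  "rank1 m = (\<chi> i k. m $ i * cnj (m $ k))"

lemma psd_rank1: "psd (rank1 m)"
proof -
  have "(rank1 m *v x) = cip m x *s m" for x
    by (simp add: rank1_def vec_eq_iff matrix_vector_mult_def cip_def sum_distrib_left mult_ac)
  then have "qform (rank1 m) x = of_real ((cmod (cip m x))\<^sup>2)" for x
    by (simp only: qform_cip cip_scale_right complex_norm_square cip_commute[of x m])
  then show ?thesis by (simp add: psd_def)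
qed

text \<open>Allowing any \<open>M\<close> matters: in \<open>gmean_eq_sum_rank1\<close> it is a
  square root of \<open>A\<close> times a unitary, so the rank one terms need not be
  orthogonal.\<close>

lemma conj_diag_eq_sum_rank1:
  "M ** diag_mat (\<lambda>i. of_real (f i)) ** mat_adj M = (\<Sum>j\<in>UNIV. f j *\<^sub>R rank1 (column j M))"
proof -
  have "(M ** diag_mat (\<lambda>i. of_real (f i)) ** mat_adj M) $ i $ k
      = (\<Sum>j\<in>UNIV. M $ i $ j * of_real (f j) * cnj (M $ k $ j))" for i k
    by (subst matrix_matrix_mult_def) (simp add: diag_mat_right mat_adj_def)
  moreover have "M $ i $ j * of_real (f j) * cnj (M $ k $ j) = (f j *\<^sub>R rank1 (column j M)) $ i $ k" for i j k
    by (simp add: rank1_def column_def) (simp add: scaleR_conv_of_real)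
  ultimately show ?thesis by (simp add: vec_eq_iff)
qed

text \<open>The geodesic is a sum of fixed rank one matrices with exponential weights.\<close>

lemma gmean_eq_sum_rank1:
  fixes A B :: "complex^'n::finite^'n"
  assumes "hermitian A" "hermitian B"
  shows "\<exists>(m :: 'n \<Rightarrow> complex^'n) c. \<forall>t. gmean A t B = (\<Sum>j\<in>UNIV. (c j powr t) *\<^sub>R rank1 (m j))"
proof -
  obtain U a where U: "unitary_mat U" "A = udiag U a" using assms(1) by (rule spectral_hermitian)
  define S T where "S = udiag U (\<lambda>i. a i powr (1/2))" and "T = udiag U (\<lambda>i. a i powr (-1/2))"
  have ST: "mat_fun (\<lambda>x. x powr (1/2)) A = S" "mat_fun (\<lambda>x. x powr (-1/2)) A = T"
    unfolding U(2) S_def T_def by (rule mat_fun_udiag[OF U(1)])+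
  have "hermitian (T ** B ** T)"
    using assms(2) by (simp add: hermitian_def mat_adj_mul T_def mat_adj_udiag matrix_mul_assoc)
  then obtain W c where W: "unitary_mat W" "T ** B ** T = udiag W c" by (rule spectral_hermitian)
  have "gmean A t B = (\<Sum>j\<in>UNIV. (c j powr t) *\<^sub>R rank1 (column j (S ** W)))" for t
  proof -
    have "gmean A t B = S ** udiag W (\<lambda>i. c i powr t) ** S"
      unfolding gmean_def Let_def ST W(2) mat_fun_udiag[OF W(1)] ..
    also have "\<dots> = S ** udiag W (\<lambda>i. c i powr t) ** mat_adj S"
      by (simp add: S_def mat_adj_udiag)
    also have "\<dots> = udiag (S ** W) (\<lambda>i. c i powr t)" by (rule udiag_conj)
    finally show ?thesis by (simp only: udiag_def conj_diag_eq_sum_rank1)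
  qed
  then show ?thesis by (intro exI allI)
qed

lemma positive_map_sum:
  assumes "positive_map \<Phi>"
  shows "\<Phi> (\<Sum>i\<in>I. f i) = (\<Sum>i\<in>I. \<Phi> (f i))"
proof -
  have add: "\<Phi> (X + Y) = \<Phi> X + \<Phi> Y" for X Y
    using assms by (simp add: positive_map_def clinear_map_def)
  have "\<Phi> 0 = 0" using add[of 0 0] by simp
  then show ?thesis
    by (induction I rule: infinite_finite_induct) (simp_all add: add)
qed

lemma mat_scale_of_real: "mat_scale (of_real a) X = a *\<^sub>R X"
  by (simp add: mat_scale_def vec_eq_iff) (simp add: scaleR_conv_of_real)

lemma positive_map_scaleR:
  assumes "positive_map \<Phi>"
  shows "\<Phi> (a *\<^sub>R X) = a *\<^sub>R \<Phi> X"
proof -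
  have "\<Phi> (mat_scale (of_real a) X) = mat_scale (of_real a) (\<Phi> X)"
    using assms by (simp add: positive_map_def clinear_map_def)
  then show ?thesis by (simp only: mat_scale_of_real)
qed

lemma psd_scaleR: "0 \<le> a \<Longrightarrow> psd A \<Longrightarrow> psd (a *\<^sub>R A)"
  by (simp add: psd_def qform_cip scaleR_matrix_vec cip_scaleR_right)

lemma psd_sum: "(\<And>i. i \<in> I \<Longrightarrow> psd (f i)) \<Longrightarrow> psd (\<Sum>i\<in>I. f i)"
  by (induction I rule: infinite_finite_induct)
     (simp_all add: psd_def qform_cip matrix_add_vec cip_add_right)

lemma psd_block_sum:
  "(\<And>i. i \<in> I \<Longrightarrow> psd_block (P i) (R i) (Q i)) \<Longrightarrow> psd_block (\<Sum>i\<in>I. P i) (\<Sum>i\<in>I. R i) (\<Sum>i\<in>I. Q i)"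
  by (induction I rule: infinite_finite_induct) (simp_all add: psd_block_add, simp_all add: psd_block_def)

theorem theorem2p1:
  fixes A B :: "'m::finite \<Rightarrow> complex^'n::finite^'n"
    and \<Phi> :: "complex^'n^'n \<Rightarrow> complex^'d::finite^'d"
    and N :: "complex^'d^'d \<Rightarrow> real"
    and g :: "real \<Rightarrow> real"
  assumes "\<And>i. pd (A i)" and "\<And>i. pd (B i)"
    and "positive_map \<Phi>"
    and "symmetric_norm N"
    and "mono_on {0..} g" and "geom_convex g"
  shows "joint_log_convex
           (\<lambda>t::real^'m. N (mat_fun g (\<Phi> (\<Sum>i\<in>UNIV. gmean (A i) (t $ i) (B i)))))"
proof -
  have "\<exists>(m :: 'n \<Rightarrow> complex^'n) c. \<forall>t. gmean (A i) t (B i) = (\<Sum>j\<in>UNIV. (c j powr t) *\<^sub>R rank1 (m j))" for i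
    by (intro gmean_eq_sum_rank1 pd_hermitian assms(1,2))
  then obtain m :: "'m \<Rightarrow> 'n \<Rightarrow> complex^'n" and c where gmean:
    "\<And>i t. gmean (A i) t (B i) = (\<Sum>j\<in>UNIV. (c i j powr t) *\<^sub>R rank1 (m i j))"
    by metis
  \<comment> \<open>Positivity of \<Phi> is applied to single rank one matrices. The blocks are
    assembled afterwards from their images, since \<Phi> is not assumed to preserve positivity of
    block matrices.\<close>
  define E where "E i j = \<Phi> (rank1 (m i j))" for i j
  have E: "psd (E i j)" for i j
    using assms(3) psd_rank1[of "m i j"] unfolding E_def positive_map_def by blast
  define F where "F t = \<Phi> (\<Sum>i\<in>UNIV. gmean (A i) (t $ i) (B i))" for t :: "real^'m"
  have F: "F t = (\<Sum>i\<in>UNIV. \<Sum>j\<in>UNIV. (c i j powr (t $ i)) *\<^sub>R E i j)" for t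
    by (simp only: F_def gmean positive_map_sum[OF assms(3)] positive_map_scaleR[OF assms(3)] E_def)
  have psdF: "psd (F t)" for t
    unfolding F by (intro psd_sum psd_scaleR E) simp
  have psd_blockF: "psd_block (F x) (F ((1/2) *\<^sub>R (x + y))) (F y)" for x y
    unfolding F
  proof (intro psd_block_sum)
    fix i j
    \<comment> \<open>Halved exponents: the weights at \<open>x\<close>, at the midpoint and at
      \<open>y\<close> become \<open>a * a\<close>, \<open>a * b\<close> and \<open>b * b\<close>,
      as \<open>psd_block_scaled_copies\<close> requires.\<close>
    define a b where "a = c i j powr (x $ i / 2)" and "b = c i j powr (y $ i / 2)"
    have "c i j powr (x $ i) = a * a" "c i j powr (y $ i) = b * b"
      "c i j powr (((1/2) *\<^sub>R (x + y)) $ i) = a * b"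
      by (simp_all add: a_def b_def add_divide_distrib flip: powr_add)
    then show "psd_block ((c i j powr (x $ i)) *\<^sub>R E i j) ((c i j powr (((1/2) *\<^sub>R (x + y)) $ i)) *\<^sub>R E i j)
        ((c i j powr (y $ i)) *\<^sub>R E i j)"
      using psd_block_scaled_copies[OF psd_hermitian[OF E] psd_Re[OF E]] by metis
  qed
  have "N (mat_fun g (F ((1/2) *\<^sub>R (x + y)))) \<le> sqrt (N (mat_fun g (F x)) * N (mat_fun g (F y)))" for x y
    by (rule norm_mat_fun_psd_block_le[OF assms(4-6) psdF psdF psdF psd_blockF])
  moreover have "0 \<le> N (mat_fun g (F x))" for x
    using assms(4) by (simp add: symmetric_norm_def)
  ultimately show ?thesis by (simp add: joint_log_convex_def F_def)
qed

end
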